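(* Let $I=(0,1)$. If $\tilde u\in C^{0,1/4}(\bar I)$ is real-valued, $H\in C^0(\bar I)$ and $H>0$ on $\bar I$, then the spectrum of the bounded operator $B_0:L^2(I)^3\to L^2(I)^3$, $$B_0\begin{pmatrix}\phi_1\\ \phi_2\\ \phi_3\end{pmatrix}=\begin{pmatrix}\tilde u\,\phi_1+H\phi_2\\ g\int_0^1\phi_1\,\mathrm{d}\lambda+\tilde u\,\phi_2+g\,\phi_3\\ 0\end{pmatrix},$$ is characterized by $$\sigma_p(B_0)=\{0\}\cup\left\{c\in\mathbb{C}\setminus\tilde u(\bar I):\int_0^1\frac{gH}{(c-\tilde u)^2}\,\mathrm{d}\lambda=1\right\}\cup\left\{c\in\tilde u(\bar I)\setminus\{0\}:\mathrm{meas}\bigl(\tilde u^{-1}(c)\bigr)>0\right\},$$ $$\sigma_c(B_0)=\left\{c\in\tilde u(\bar I)\setminus\{0\}:\mathrm{meas}\bigl(\tilde u^{-1}(c)\bigr)=0\right\},\qquad \sigma_r(B_0)=\emptyset.$$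
   Context: $g>0$ is a constant; $\bar I=[0,1]$; $L^2(I)$ is the space of complex-valued square integrable functions; $\mathrm{meas}$ is Lebesgue measure; $C^{0,1/4}(\bar I)$ is the space of Hölder continuous functions of index $1/4$. For a bounded operator $A$ and $\mathbf{I}$ the identity: the point spectrum $\sigma_p(A)$ is the set of $c\in\mathbb{C}$ such that $A-c\mathbf{I}$ is not injective; the continuous spectrum $\sigma_c(A)$ is the set of $c$ such that $A-c\mathbf{I}$ is injective with range dense but not equal to the whole space; the residual spectrum $\sigma_r(A)$ is the set of $c$ such that $A-c\mathbf{I}$ is injective and its range is not dense. *)

theory Defs
  imports "HOL-Analysis.Analysis"
begin

section \<open>Complex normed spaces and the parts of the spectrum\<close>

class scaleC =
  fixes scaleC :: "complex \<Rightarrow> 'a \<Rightarrow> 'a"  (infixr \<open>*\<^sub>C\<close> 75)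

class complex_normed_vector = scaleC + real_normed_vector +
  assumes scaleC_add_right: "a *\<^sub>C (x + y) = a *\<^sub>C x + a *\<^sub>C y"
    and scaleC_add_left: "(a + b) *\<^sub>C x = a *\<^sub>C x + b *\<^sub>C x"
    and scaleC_scaleC: "a *\<^sub>C b *\<^sub>C x = (a * b) *\<^sub>C x"
    and scaleR_scaleC: "r *\<^sub>R x = complex_of_real r *\<^sub>C x"
    and norm_scaleC: "norm (a *\<^sub>C x) = cmod a * norm x"

instantiation prod :: (complex_normed_vector, complex_normed_vector) complex_normed_vector
begin

definition scaleC_prod :: "complex \<Rightarrow> 'a \<times> 'b \<Rightarrow> 'a \<times> 'b"
  where "scaleC_prod c x = (c *\<^sub>C fst x, c *\<^sub>C snd x)"

instance
proof
  fix a b :: complex and x y :: "'a \<times> 'b" and r :: real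
  show "norm (a *\<^sub>C x) = cmod a * norm x"
    by (simp add: scaleC_prod_def norm_prod_def norm_scaleC power_mult_distrib
        real_sqrt_mult flip: distrib_left)
qed (simp_all add: scaleC_prod_def scaleC_add_right scaleC_add_left scaleC_scaleC
      scaleR_scaleC prod_eq_iff)

end

definition point_spectrum :: "('a::complex_normed_vector \<Rightarrow> 'a) \<Rightarrow> complex set"
  where "point_spectrum A = {c. \<not> inj (\<lambda>x. A x - c *\<^sub>C x)}"

definition continuous_spectrum :: "('a::complex_normed_vector \<Rightarrow> 'a) \<Rightarrow> complex set"
  where "continuous_spectrum A =
    {c. inj (\<lambda>x. A x - c *\<^sub>C x) \<and>
        closure (range (\<lambda>x. A x - c *\<^sub>C x)) = UNIV \<and>
        range (\<lambda>x. A x - c *\<^sub>C x) \<noteq> UNIV}"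

definition residual_spectrum :: "('a::complex_normed_vector \<Rightarrow> 'a) \<Rightarrow> complex set"
  where "residual_spectrum A =
    {c. inj (\<lambda>x. A x - c *\<^sub>C x) \<and>
        closure (range (\<lambda>x. A x - c *\<^sub>C x)) \<noteq> UNIV}"


section \<open>The space of square integrable functions on the unit interval\<close>

abbreviation leb_I :: "real measure"
  where "leb_I \<equiv> lebesgue_on {0<..<1}"

definition square_integrable :: "(real \<Rightarrow> complex) \<Rightarrow> bool"
  where "square_integrable f \<longleftrightarrow>
    f \<in> borel_measurable leb_I \<and> integrable leb_I (\<lambda>x. (cmod (f x))\<^sup>2)"

definition l2_rel :: "(real \<Rightarrow> complex) \<Rightarrow> (real \<Rightarrow> complex) \<Rightarrow> bool"
  where "l2_rel f h \<longleftrightarrow>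
    square_integrable f \<and> square_integrable h \<and> (AE x in leb_I. f x = h x)"

lemma square_integrable_measurable:
  "square_integrable f \<Longrightarrow> f \<in> borel_measurable leb_I"
  by (simp add: square_integrable_def)

lemma square_integrable_bound:
  assumes "f \<in> borel_measurable leb_I" "integrable leb_I w"
    and "\<And>x. x \<in> {0<..<1} \<Longrightarrow> (cmod (f x))\<^sup>2 \<le> w x"
  shows "square_integrable f"
  unfolding square_integrable_def
proof
  show "integrable leb_I (\<lambda>x. (cmod (f x))\<^sup>2)"
    using assms(1) by (intro Bochner_Integration.integrable_bound[OF assms(2)] AE_I2)
      (auto intro!: order_trans[OF assms(3)])
qed fact

lemma square_integrable_0: "square_integrable (\<lambda>x. 0)"
  by (simp add: square_integrable_def)

lemma finite_measure_leb_I: "finite_measure leb_I"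
  by (rule finite_measureI) (simp add: emeasure_restrict_space space_restrict_space)

lemma square_integrable_const: "square_integrable (\<lambda>x. c)"
  by (simp add: square_integrable_def finite_measure.integrable_const[OF finite_measure_leb_I])

lemma cmod_add_power2_le: "(cmod (a + b))\<^sup>2 \<le> 2 * (cmod a)\<^sup>2 + 2 * (cmod b)\<^sup>2"
proof -
  have "(cmod (a + b))\<^sup>2 \<le> (cmod a + cmod b)\<^sup>2"
    by (intro power_mono norm_triangle_ineq) auto
  also have "\<dots> \<le> 2 * (cmod a)\<^sup>2 + 2 * (cmod b)\<^sup>2"
    using zero_le_power2[of "cmod a - cmod b"] by (simp add: power2_eq_square algebra_simps)
  finally show ?thesis .
qed

lemma square_integrable_add:
  assumes "square_integrable f" "square_integrable h"
  shows "square_integrable (\<lambda>x. f x + h x)"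
  using assms
  by (intro square_integrable_bound[where w = "\<lambda>x. 2 * (cmod (f x))\<^sup>2 + 2 * (cmod (h x))\<^sup>2"])
     (auto simp: square_integrable_def cmod_add_power2_le)

lemma square_integrable_mult:
  assumes "square_integrable f" "m \<in> borel_measurable leb_I"
    and "\<And>x. x \<in> {0<..<1} \<Longrightarrow> cmod (m x) \<le> K"
  shows "square_integrable (\<lambda>x. m x * f x)"
proof (rule square_integrable_bound[where w = "\<lambda>x. K\<^sup>2 * (cmod (f x))\<^sup>2"])
  fix x :: real assume "x \<in> {0<..<1}"
  from assms(3)[OF this] show "(cmod (m x * f x))\<^sup>2 \<le> K\<^sup>2 * (cmod (f x))\<^sup>2"
    by (simp add: norm_mult power_mult_distrib mult_right_mono power_mono)
qed (use assms in \<open>auto simp: square_integrable_def\<close>)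

lemma square_integrable_cmult:
  "square_integrable f \<Longrightarrow> square_integrable (\<lambda>x. c * f x)"
  by (rule square_integrable_mult[where K = "cmod c"]) auto

lemma square_integrable_uminus:
  "square_integrable f \<Longrightarrow> square_integrable (\<lambda>x. - f x)"
  using square_integrable_cmult[of f "-1"] by simp

lemma square_integrable_diff:
  "square_integrable f \<Longrightarrow> square_integrable h \<Longrightarrow> square_integrable (\<lambda>x. f x - h x)"
  using square_integrable_add[of f "\<lambda>x. - h x"] square_integrable_uminus[of h] by simp

lemma integrable_inner_square_integrable:
  assumes "square_integrable f" "square_integrable h"
  shows "integrable leb_I (\<lambda>x. f x \<bullet> h x)"
proof (rule Bochner_Integration.integrable_bound)
  show "integrable leb_I (\<lambda>x. (cmod (f x))\<^sup>2 + (cmod (h x))\<^sup>2)"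
    using assms by (auto simp: square_integrable_def)
  show "AE x in leb_I. norm (f x \<bullet> h x) \<le> norm ((cmod (f x))\<^sup>2 + (cmod (h x))\<^sup>2)"
  proof (rule AE_I2)
    fix x
    have "\<bar>f x \<bullet> h x\<bar> \<le> cmod (f x) * cmod (h x)" by (rule Cauchy_Schwarz_ineq2)
    also have "\<dots> \<le> (cmod (f x))\<^sup>2 + (cmod (h x))\<^sup>2"
      using zero_le_power2[of "cmod (f x) - cmod (h x)"]
            mult_nonneg_nonneg[OF norm_ge_zero[of "f x"] norm_ge_zero[of "h x"]]
      unfolding power2_diff by linarith
    finally show "norm (f x \<bullet> h x) \<le> norm ((cmod (f x))\<^sup>2 + (cmod (h x))\<^sup>2)" by simp
  qed
qed (use assms in \<open>auto simp: square_integrable_def\<close>)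

quotient_type l2 = "real \<Rightarrow> complex" / partial: l2_rel
proof (rule part_equivpI)
  show "\<exists>f. l2_rel f f"
    using square_integrable_0 by (auto simp: l2_rel_def)
  show "symp l2_rel"
    by (auto simp: symp_def l2_rel_def)
  show "transp l2_rel"
    unfolding transp_def l2_rel_def by (auto elim: AE_mp)
qed

instantiation l2 :: real_vector
begin

lift_definition zero_l2 :: l2 is "\<lambda>x. 0"
  by (simp add: l2_rel_def square_integrable_0)

lift_definition plus_l2 :: "l2 \<Rightarrow> l2 \<Rightarrow> l2" is "\<lambda>f h x. f x + h x"
  unfolding l2_rel_def by (auto intro: square_integrable_add)

lift_definition uminus_l2 :: "l2 \<Rightarrow> l2" is "\<lambda>f x. - f x"
  unfolding l2_rel_def by (auto intro: square_integrable_uminus)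

lift_definition minus_l2 :: "l2 \<Rightarrow> l2 \<Rightarrow> l2" is "\<lambda>f h x. f x - h x"
  unfolding l2_rel_def by (auto intro: square_integrable_diff)

lift_definition scaleR_l2 :: "real \<Rightarrow> l2 \<Rightarrow> l2" is "\<lambda>r f x. complex_of_real r * f x"
  unfolding l2_rel_def by (auto intro: square_integrable_cmult)

instance
proof
  fix x y z :: l2 and a b :: real
  show "x + y + z = x + (y + z)"
    by transfer (auto simp: l2_rel_def add.assoc intro!: square_integrable_add)
  show "x + y = y + x"
    by transfer (auto simp: l2_rel_def add.commute intro!: square_integrable_add)
  show "0 + x = x"
    by transfer (auto simp: l2_rel_def)
  show "- x + x = 0"
    by transfer (auto simp: l2_rel_def square_integrable_0)
  show "x - y = x + - y"
    by transfer (auto simp: l2_rel_def intro!: square_integrable_diff)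
  show "a *\<^sub>R (x + y) = a *\<^sub>R x + a *\<^sub>R y"
    by transfer (auto simp: l2_rel_def distrib_left
        intro!: square_integrable_add square_integrable_cmult)
  show "(a + b) *\<^sub>R x = a *\<^sub>R x + b *\<^sub>R x"
    by transfer (auto simp: l2_rel_def distrib_right
        intro!: square_integrable_add square_integrable_cmult)
  show "a *\<^sub>R b *\<^sub>R x = (a * b) *\<^sub>R x"
    by transfer (auto simp: l2_rel_def mult.assoc intro!: square_integrable_cmult)
  show "1 *\<^sub>R x = x"
    by transfer (auto simp: l2_rel_def)
qed

end

instantiation l2 :: real_inner
begin

text \<open>
  On the complex numbers, \<open>z \<bullet> w\<close> is \<open>Re (z * cnj w)\<close>; so this is the real part of the
  usual sesquilinear inner product, and it induces the usual norm.
\<close>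

lift_definition inner_l2 :: "l2 \<Rightarrow> l2 \<Rightarrow> real" is "\<lambda>f h. \<integral>x. f x \<bullet> h x \<partial>leb_I"
  unfolding l2_rel_def
  by (intro integral_cong_AE)
     (auto intro!: borel_measurable_inner square_integrable_measurable)

lift_definition norm_l2 :: "l2 \<Rightarrow> real" is "\<lambda>f. sqrt (\<integral>x. (cmod (f x))\<^sup>2 \<partial>leb_I)"
  unfolding l2_rel_def square_integrable_def
  by (auto intro!: integral_cong_AE)

definition dist_l2 :: "l2 \<Rightarrow> l2 \<Rightarrow> real"
  where "dist_l2 x y = norm (x - y)"

definition sgn_l2 :: "l2 \<Rightarrow> l2"
  where "sgn_l2 x = inverse (norm x) *\<^sub>R x"

definition uniformity_l2 :: "(l2 \<times> l2) filter"
  where "uniformity_l2 = (INF e\<in>{0<..}. principal {(x, y). dist x y < e})"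

definition open_l2 :: "l2 set \<Rightarrow> bool"
  where "open_l2 S \<longleftrightarrow> (\<forall>x\<in>S. \<forall>\<^sub>F (x', y) in uniformity. x' = x \<longrightarrow> y \<in> S)"

instance
proof
  fix x y z :: l2 and r :: real
  show "dist x y = norm (x - y)"
    by (rule dist_l2_def)
  show "sgn x = x /\<^sub>R norm x"
    by (rule sgn_l2_def)
  show "(uniformity :: (l2 \<times> l2) filter) = (INF e\<in>{0<..}. principal {(x, y). dist x y < e})"
    by (rule uniformity_l2_def)
  show "open S \<longleftrightarrow> (\<forall>x\<in>S. \<forall>\<^sub>F (x', y) in uniformity. x' = x \<longrightarrow> y \<in> S)" for S :: "l2 set"
    by (rule open_l2_def)
  show "x \<bullet> y = y \<bullet> x"
    by transfer (simp add: inner_commute)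
  show "(x + y) \<bullet> z = x \<bullet> z + y \<bullet> z"
    by transfer
       (simp add: l2_rel_def inner_add_left Bochner_Integration.integral_add integrable_inner_square_integrable)
  show "(r *\<^sub>R x) \<bullet> y = r * (x \<bullet> y)"
    by transfer (simp flip: scaleR_conv_of_real)
  show "0 \<le> x \<bullet> x"
    by transfer (simp add: integral_nonneg_AE)
  show "x \<bullet> x = 0 \<longleftrightarrow> x = 0"
  proof transfer
    fix f assume "l2_rel f f"
    then have f: "square_integrable f" by (simp add: l2_rel_def)
    have "(\<integral>x. f x \<bullet> f x \<partial>leb_I) = 0 \<longleftrightarrow> (AE x in leb_I. f x \<bullet> f x = 0)"
      by (intro integral_nonneg_eq_0_iff_AE integrable_inner_square_integrable f) auto
    then show "(\<integral>x. f x \<bullet> f x \<partial>leb_I) = 0 \<longleftrightarrow> l2_rel f (\<lambda>x. 0)"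
      using f by (simp add: l2_rel_def square_integrable_0)
  qed
  show "norm x = sqrt (x \<bullet> x)"
    by transfer (simp add: power2_norm_eq_inner)
qed

end

instantiation l2 :: complex_normed_vector
begin

lift_definition scaleC_l2 :: "complex \<Rightarrow> l2 \<Rightarrow> l2" is "\<lambda>c f x. c * f x"
  unfolding l2_rel_def by (auto intro: square_integrable_cmult)

instance
proof
  fix x y :: l2 and a b :: complex and r :: real
  show "a *\<^sub>C (x + y) = a *\<^sub>C x + a *\<^sub>C y"
    by transfer (auto simp: l2_rel_def distrib_left
        intro!: square_integrable_add square_integrable_cmult)
  show "(a + b) *\<^sub>C x = a *\<^sub>C x + b *\<^sub>C x"
    by transfer (auto simp: l2_rel_def distrib_right
        intro!: square_integrable_add square_integrable_cmult)
  show "a *\<^sub>C b *\<^sub>C x = (a * b) *\<^sub>C x"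
    by transfer (auto simp: l2_rel_def mult.assoc intro!: square_integrable_cmult)
  show "r *\<^sub>R x = complex_of_real r *\<^sub>C x"
    by transfer (auto simp: l2_rel_def intro!: square_integrable_cmult)
  show "norm (a *\<^sub>C x) = cmod a * norm x"
    by transfer (simp add: norm_mult power_mult_distrib real_sqrt_mult)
qed

end

text \<open>
  \<open>abs_l2 f\<close> is the class of the square integrable function \<open>f\<close>, and \<open>rep_l2 x\<close> is a chosen
  representative of the class \<open>x\<close>.
\<close>

lemma square_integrable_rep_l2: "square_integrable (rep_l2 x)"
  using Quotient_rep_reflp[OF Quotient_l2] unfolding l2_rel_def by blast

lemma abs_l2_rep_l2: "abs_l2 (rep_l2 x) = x"
  by (rule Quotient_abs_rep[OF Quotient_l2])

lemma rep_l2_abs_l2: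
  assumes "square_integrable f"
  shows "AE x in leb_I. rep_l2 (abs_l2 f) x = f x"
  using Quotient_rep_abs[OF Quotient_l2, of f] assms by (simp add: l2_rel_def)

lemma abs_l2_eqI:
  assumes "square_integrable f" "square_integrable h" "AE x in leb_I. f x = h x"
  shows "abs_l2 f = abs_l2 h"
  using Quotient_rel_abs[OF Quotient_l2, of f h] assms by (simp add: l2_rel_def)


section \<open>The operator\<close>

definition hoelder_on :: "real \<Rightarrow> real set \<Rightarrow> (real \<Rightarrow> real) \<Rightarrow> bool"
  where "hoelder_on \<alpha> S f \<longleftrightarrow>
    (\<exists>C\<ge>0. \<forall>x\<in>S. \<forall>y\<in>S. \<bar>f x - f y\<bar> \<le> C * \<bar>x - y\<bar> powr \<alpha>)"

definition B0 :: "real \<Rightarrow> (real \<Rightarrow> real) \<Rightarrow> (real \<Rightarrow> real) \<Rightarrow> l2 \<times> l2 \<times> l2 \<Rightarrow> l2 \<times> l2 \<times> l2"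
  where "B0 g u H = (\<lambda>(\<phi>\<^sub>1, \<phi>\<^sub>2, \<phi>\<^sub>3).
    (abs_l2 (\<lambda>x. of_real (u x) * rep_l2 \<phi>\<^sub>1 x + of_real (H x) * rep_l2 \<phi>\<^sub>2 x),
     abs_l2 (\<lambda>x. of_real g * (\<integral>y. rep_l2 \<phi>\<^sub>1 y \<partial>leb_I)
                 + of_real (u x) * rep_l2 \<phi>\<^sub>2 x + of_real g * rep_l2 \<phi>\<^sub>3 x),
     0))"

text \<open>
  For continuous coefficients the functions in the definition of \<^const>\<open>B0\<close> are square
  integrable, the result does not depend on the chosen representatives, and the operator is
  complex linear and bounded.
\<close>

lemma continuous_coeff:
  assumes "continuous_on {0..1} (w :: real \<Rightarrow> real)"
  obtains K where "(\<lambda>x. complex_of_real (w x)) \<in> borel_measurable leb_I"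
    "\<And>x. x \<in> {0<..<1} \<Longrightarrow> cmod (complex_of_real (w x)) \<le> K"
proof -
  have "compact (w ` {0..1})"
    by (intro compact_continuous_image assms compact_Icc)
  then obtain K where K: "\<And>x. x \<in> {0..1} \<Longrightarrow> \<bar>w x\<bar> \<le> K"
    by (metis (no_types, lifting) bounded_iff compact_imp_bounded image_eqI real_norm_def)
  have "continuous_on {0<..<1} (\<lambda>x. complex_of_real (w x))"
    by (intro continuous_on_of_real continuous_on_subset[OF assms]) auto
  then have "(\<lambda>x. complex_of_real (w x)) \<in> borel_measurable leb_I"
    by (intro continuous_imp_measurable_on_sets_lebesgue) auto
  with K show ?thesis by (intro that[of K]) auto
qed

lemma square_integrable_coeff:
  assumes "continuous_on {0..1} w" "square_integrable f"
  shows "square_integrable (\<lambda>x. of_real (w x) * f x)"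
proof -
  obtain K where "(\<lambda>x. complex_of_real (w x)) \<in> borel_measurable leb_I"
    "\<And>x. x \<in> {0<..<1} \<Longrightarrow> cmod (complex_of_real (w x)) \<le> K"
    using continuous_coeff[OF assms(1)] by metis
  then show ?thesis by (intro square_integrable_mult assms(2))
qed

lemma integral_rep_l2_abs_l2:
  assumes "square_integrable f"
  shows "(\<integral>x. rep_l2 (abs_l2 f) x \<partial>leb_I) = (\<integral>x. f x \<partial>leb_I)"
  using assms by (intro integral_cong_AE rep_l2_abs_l2 square_integrable_measurable
      square_integrable_rep_l2)

lemma B0_abs_l2:
  assumes u: "continuous_on {0..1} u" and H: "continuous_on {0..1} H"
    and f: "square_integrable f1" "square_integrable f2" "square_integrable f3"
  shows "B0 g u H (abs_l2 f1, abs_l2 f2, abs_l2 f3) =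
    (abs_l2 (\<lambda>x. of_real (u x) * f1 x + of_real (H x) * f2 x),
     abs_l2 (\<lambda>x. of_real g * (\<integral>y. f1 y \<partial>leb_I) + of_real (u x) * f2 x + of_real g * f3 x),
     0)"
  unfolding B0_def split_conv integral_rep_l2_abs_l2[OF f(1)] prod.inject
  using rep_l2_abs_l2[OF f(1)] rep_l2_abs_l2[OF f(2)] rep_l2_abs_l2[OF f(3)]
  by (intro conjI abs_l2_eqI refl)
     (auto intro!: square_integrable_add square_integrable_coeff u H f
        square_integrable_const square_integrable_cmult square_integrable_rep_l2)

lemma integrable_square_integrable:
  assumes "square_integrable f"
  shows "integrable leb_I f"
proof (rule Bochner_Integration.integrable_bound)
  show "integrable leb_I (\<lambda>x. 1 + (cmod (f x))\<^sup>2)"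
    using assms square_integrable_const[of 1]
    by (intro Bochner_Integration.integrable_add) (auto simp: square_integrable_def)
  show "AE x in leb_I. norm (f x) \<le> norm (1 + (cmod (f x))\<^sup>2)"
  proof (rule AE_I2)
    fix x
    show "norm (f x) \<le> norm (1 + (cmod (f x))\<^sup>2)"
      using zero_le_power2[of "cmod (f x) - 1"] norm_ge_zero[of "f x"]
      unfolding power2_diff by (simp; linarith)
  qed
qed (use assms in \<open>simp add: square_integrable_measurable\<close>)

lemma plus_abs_l2:
  "square_integrable f \<Longrightarrow> square_integrable h \<Longrightarrow> abs_l2 f + abs_l2 h = abs_l2 (\<lambda>x. f x + h x)"
  by (simp add: plus_l2.abs_eq l2_rel_def)

lemma scaleC_abs_l2: "square_integrable f \<Longrightarrow> c *\<^sub>C abs_l2 f = abs_l2 (\<lambda>x. c * f x)"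
  by (simp add: scaleC_l2.abs_eq l2_rel_def)

lemma l2_cases:
  obtains f where "square_integrable f" "x = abs_l2 f"
  by (metis abs_l2_rep_l2 square_integrable_rep_l2)

lemma complex_linear_B0:
  assumes u: "continuous_on {0..1} u" and H: "continuous_on {0..1} H"
  shows "B0 g u H (\<phi> + \<psi>) = B0 g u H \<phi> + B0 g u H \<psi>"
    and "B0 g u H (c *\<^sub>C \<phi>) = c *\<^sub>C B0 g u H \<phi>"
proof -
  obtain f1 f2 f3 h1 h2 h3 where
    \<phi>: "\<phi> = (abs_l2 f1, abs_l2 f2, abs_l2 f3)" and \<psi>: "\<psi> = (abs_l2 h1, abs_l2 h2, abs_l2 h3)"
    and f: "square_integrable f1" "square_integrable f2" "square_integrable f3"
    and h: "square_integrable h1" "square_integrable h2" "square_integrable h3"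
    by (metis l2_cases prod_cases3)
  note [intro] = square_integrable_add square_integrable_coeff[OF u] square_integrable_coeff[OF H]
    square_integrable_const square_integrable_cmult f h
  have sum: "(\<integral>x. f1 x + h1 x \<partial>leb_I) = (\<integral>x. f1 x \<partial>leb_I) + (\<integral>x. h1 x \<partial>leb_I)"
    by (intro Bochner_Integration.integral_add integrable_square_integrable f h)
  have z: "c *\<^sub>C (0::l2) = 0" using norm_scaleC[of c "0::l2"] by simp
  show "B0 g u H (\<phi> + \<psi>) = B0 g u H \<phi> + B0 g u H \<psi>"
    unfolding \<phi> \<psi> add_Pair
    by (simp add: plus_abs_l2 B0_abs_l2 u H f h sum square_integrable_add
        square_integrable_coeff square_integrable_const square_integrable_cmult)
       (simp add: algebra_simps)
  show "B0 g u H (c *\<^sub>C \<phi>) = c *\<^sub>C B0 g u H \<phi>"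
    unfolding \<phi> scaleC_prod_def fst_conv snd_conv
    by (simp add: scaleC_abs_l2 B0_abs_l2 u H f z square_integrable_add
        square_integrable_coeff square_integrable_const square_integrable_cmult)
       (simp add: algebra_simps)
qed

lemma norm_abs_l2:
  "square_integrable f \<Longrightarrow> norm (abs_l2 f) = sqrt (\<integral>x. (cmod (f x))\<^sup>2 \<partial>leb_I)"
  by (simp add: norm_l2.abs_eq l2_rel_def)

lemma norm_abs_l2_const: "norm (abs_l2 (\<lambda>x. k)) = cmod k"
  by (simp add: norm_abs_l2 square_integrable_const measure_restrict_space space_restrict_space)

lemma norm_abs_l2_coeff_le:
  assumes "continuous_on {0..1} w"
  obtains K where "\<And>f. square_integrable f \<Longrightarrow>
    norm (abs_l2 (\<lambda>x. of_real (w x) * f x)) \<le> K * norm (abs_l2 f)"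
proof -
  obtain K where K: "\<And>x. x \<in> {0<..<1} \<Longrightarrow> cmod (complex_of_real (w x)) \<le> K"
    using continuous_coeff[OF assms] by metis
  have K0: "K \<ge> 0" using K[of "1/2"] by (auto intro: order_trans[OF norm_ge_zero])
  have "norm (abs_l2 (\<lambda>x. of_real (w x) * f x)) \<le> K * norm (abs_l2 f)"
    if f: "square_integrable f" for f
  proof -
    have wf: "square_integrable (\<lambda>x. of_real (w x) * f x)"
      by (intro square_integrable_coeff assms f)
    have "(\<integral>x. (cmod (of_real (w x) * f x))\<^sup>2 \<partial>leb_I) \<le> (\<integral>x. K\<^sup>2 * (cmod (f x))\<^sup>2 \<partial>leb_I)"
    proof (rule integral_mono)
      fix x assume "x \<in> space leb_I"
      then have "cmod (of_real (w x)) \<le> K" by (intro K) (simp add: space_restrict_space)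
      then have "(cmod (of_real (w x)))\<^sup>2 \<le> K\<^sup>2" by (intro power_mono) auto
      then show "(cmod (of_real (w x) * f x))\<^sup>2 \<le> K\<^sup>2 * (cmod (f x))\<^sup>2"
        unfolding norm_mult power_mult_distrib by (intro mult_right_mono) auto
    qed (use f wf in \<open>simp_all add: square_integrable_def\<close>)
    also have "\<dots> = K\<^sup>2 * (\<integral>x. (cmod (f x))\<^sup>2 \<partial>leb_I)" by simp
    finally show ?thesis
      using K0 by (simp add: norm_abs_l2 wf f real_le_rsqrt real_sqrt_mult
          flip: real_sqrt_le_iff[where y = "K\<^sup>2 * _"])
  qed
  then show ?thesis by (rule that)
qed

lemma norm_integral_le_norm_abs_l2:
  assumes "square_integrable f"
  shows "cmod (\<integral>x. f x \<partial>leb_I) \<le> norm (abs_l2 f)"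
proof -
  define k where "k = (\<integral>x. f x \<partial>leb_I)"
  have "abs_l2 f \<bullet> abs_l2 (\<lambda>x. k) = (\<integral>x. f x \<bullet> k \<partial>leb_I)"
    by (simp add: inner_l2.abs_eq l2_rel_def assms square_integrable_const)
  also have "\<dots> = k \<bullet> k"
    unfolding k_def by (intro integral_inner_left integrable_square_integrable assms)
  finally have "(cmod k)\<^sup>2 \<le> norm (abs_l2 f) * cmod k"
    using norm_cauchy_schwarz[of "abs_l2 f" "abs_l2 (\<lambda>x. k)"]
    by (simp add: norm_abs_l2_const power2_norm_eq_inner)
  then show ?thesis
    unfolding k_def[symmetric] by (cases "k = 0") (simp_all add: power2_eq_square)
qed

lemma bounded_linear_B0:
  assumes u: "continuous_on {0..1} u" and H: "continuous_on {0..1} H"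
  shows "bounded_linear (B0 g u H)"
proof -
  have R: "r *\<^sub>R x = complex_of_real r *\<^sub>C x" for r and x :: "l2 \<times> l2 \<times> l2"
    by (rule scaleR_scaleC)
  obtain Ku where Ku: "\<And>f. square_integrable f \<Longrightarrow>
      norm (abs_l2 (\<lambda>x. of_real (u x) * f x)) \<le> Ku * norm (abs_l2 f)"
    using norm_abs_l2_coeff_le[OF u] by metis
  obtain KH where KH: "\<And>f. square_integrable f \<Longrightarrow>
      norm (abs_l2 (\<lambda>x. of_real (H x) * f x)) \<le> KH * norm (abs_l2 f)"
    using norm_abs_l2_coeff_le[OF H] by metis
  show ?thesis
  proof (rule bounded_linear_intro)
    fix \<phi> \<psi> :: "l2 \<times> l2 \<times> l2" and r :: real
    show "B0 g u H (\<phi> + \<psi>) = B0 g u H \<phi> + B0 g u H \<psi>"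
      by (rule complex_linear_B0[OF u H])
    show "B0 g u H (r *\<^sub>R \<phi>) = r *\<^sub>R B0 g u H \<phi>"
      unfolding R by (rule complex_linear_B0[OF u H])
    obtain f1 f2 f3 where \<phi>: "\<phi> = (abs_l2 f1, abs_l2 f2, abs_l2 f3)"
      and f: "square_integrable f1" "square_integrable f2" "square_integrable f3"
      by (metis l2_cases prod_cases3)
    define N where "N = norm \<phi>"
    have N: "norm (abs_l2 f1) \<le> N" "norm (abs_l2 f2) \<le> N" "norm (abs_l2 f3) \<le> N"
      unfolding N_def \<phi>
      using norm_fst_le[of "abs_l2 f1" "(abs_l2 f2, abs_l2 f3)"]
        norm_snd_le[of "(abs_l2 f2, abs_l2 f3)" "abs_l2 f1"]
        norm_fst_le[of "abs_l2 f2" "abs_l2 f3"] norm_snd_le[of "abs_l2 f3" "abs_l2 f2"]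
      by linarith+
    have le: "a * norm (x::l2) \<le> \<bar>a\<bar> * N" if "norm x \<le> N" for a x
      using that abs_ge_self[of a] by (meson abs_ge_zero mult_left_mono mult_right_mono norm_ge_zero order_trans)
    let ?k = "\<integral>x. f1 x \<partial>leb_I"
    have B: "B0 g u H \<phi> =
      (abs_l2 (\<lambda>x. of_real (u x) * f1 x) + abs_l2 (\<lambda>x. of_real (H x) * f2 x),
       abs_l2 (\<lambda>x. of_real g * ?k) + abs_l2 (\<lambda>x. of_real (u x) * f2 x)
         + of_real g *\<^sub>C abs_l2 f3, 0)" (is "_ = (?a + ?b, ?c + ?d + ?e, 0)")
      unfolding \<phi>
      by (simp add: plus_abs_l2 scaleC_abs_l2 B0_abs_l2 u H f square_integrable_add
        square_integrable_coeff square_integrable_const square_integrable_cmult)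
    have "norm ?c \<le> \<bar>g\<bar> * N"
      using norm_integral_le_norm_abs_l2[OF f(1)] N(1)
      by (simp add: norm_abs_l2_const norm_mult mult_left_mono)
    moreover have "norm ?e \<le> \<bar>g\<bar> * N"
      using N(3) by (simp add: norm_scaleC mult_left_mono)
    moreover have "norm ?a \<le> \<bar>Ku\<bar> * N" "norm ?d \<le> \<bar>Ku\<bar> * N" "norm ?b \<le> \<bar>KH\<bar> * N"
      by (rule order_trans[OF Ku[OF f(1)] le[OF N(1)]] order_trans[OF Ku[OF f(2)] le[OF N(2)]]
          order_trans[OF KH[OF f(2)] le[OF N(2)]])+
    moreover have "norm (B0 g u H \<phi>) \<le> norm (?a + ?b) + norm (?c + ?d + ?e)"
      unfolding B
      using norm_Pair_le[of "?a + ?b" "(?c + ?d + ?e, 0::l2)"] norm_Pair_le[of "?c + ?d + ?e" "0::l2"]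
      by simp
    moreover have "\<dots> \<le> norm ?a + norm ?b + (norm ?c + norm ?d + norm ?e)"
      by (intro add_mono norm_triangle_ineq norm_triangle_le order_refl)
    ultimately have "norm (B0 g u H \<phi>) \<le> (2 * \<bar>g\<bar> + 2 * \<bar>Ku\<bar> + \<bar>KH\<bar>) * N"
      unfolding distrib_right by linarith
    then show "norm (B0 g u H \<phi>) \<le> norm \<phi> * (2 * \<bar>g\<bar> + 2 * \<bar>Ku\<bar> + \<bar>KH\<bar>)"
      by (simp add: N_def mult.commute)
  qed
qed

end

theory Submission
  imports Defs
begin

text \<open>
  For \<open>c \<noteq> 0\<close> the third component of \<open>(B\<^sub>0 - c) \<phi> = h\<close> determines \<open>\<phi>\<^sub>3\<close>, and off the range of \<open>u\<close>
  the first two components express \<open>\<phi>\<^sub>1\<close> and \<open>\<phi>\<^sub>2\<close> through the single number \<open>k = \<integral> \<phi>\<^sub>1\<close>, for which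
  they leave the scalar equation \<open>(1 - \<integral> g H / (c - u)\<^sup>2) k = const\<close>. If \<open>c\<close> is in the range of \<open>u\<close> and
  its level set has positive measure, functions \<open>\<phi>\<^sub>1\<close> of mean zero on the level set are
  eigenfunctions. If the level set is null, the Hoelder exponent \<open>1/4\<close> is exactly what makes
  \<open>1 / (u - c)\<^sup>4\<close> fail to be integrable; this forces \<open>k = 0\<close> in the homogeneous equation, excludes
  \<open>(0, 1, 0)\<close> from the range, and allows arbitrarily small right-hand sides to correct \<open>k\<close>, so that
  the range is dense.
\<close>

section \<open>Classes, representatives and multipliers on the unit interval\<close>

lemma space_leb_I: "space leb_I = {0<..<1}"
  by (simp add: space_restrict_space)

lemma not_AE_leb_I_False: "\<not> (AE x in leb_I. False)"
proof
  assume "AE x in leb_I. False"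
  then have "emeasure leb_I (space leb_I) = 0"
    by (subst (asm) AE_iff_measurable[OF sets.top]) auto
  then show False
    by (simp add: space_leb_I emeasure_restrict_space)
qed

text \<open>The direction from left to right recovers almost everywhere equations from equations
  between classes.\<close>

lemma abs_l2_eq_iff:
  assumes "square_integrable f" "square_integrable h"
  shows "abs_l2 f = abs_l2 h \<longleftrightarrow> (AE x in leb_I. f x = h x)"
  using Quotient_rel_abs[OF Quotient_l2, of f h] Quotient_rel[OF Quotient_l2, of f h] assms
  by (auto simp: l2_rel_def)

lemma minus_abs_l2:
  "square_integrable f \<Longrightarrow> square_integrable h \<Longrightarrow> abs_l2 f - abs_l2 h = abs_l2 (\<lambda>x. f x - h x)"
  by (simp add: minus_l2.abs_eq l2_rel_def)

text \<open>The multiplier is complex-valued because \<open>u - c\<close> and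
  \<open>1 / (u - c)\<close> are, for complex \<open>c\<close>.\<close>

lemma square_integrable_continuous_mult:
  fixes w :: "real \<Rightarrow> complex"
  assumes "continuous_on {0..1} w" "square_integrable f"
  shows "square_integrable (\<lambda>x. w x * f x)"
proof -
  have "compact (w ` {0..1})"
    by (intro compact_continuous_image assms compact_Icc)
  then obtain K where K: "\<And>x. x \<in> {0..1} \<Longrightarrow> cmod (w x) \<le> K"
    by (metis (no_types, lifting) bounded_iff compact_imp_bounded image_eqI)
  have "continuous_on {0<..<1} w"
    by (rule continuous_on_subset[OF assms(1)]) auto
  then have "w \<in> borel_measurable leb_I"
    by (intro continuous_imp_measurable_on_sets_lebesgue) auto
  with K show ?thesis
    by (intro square_integrable_mult[OF assms(2), where K = K]) auto
qed

lemma square_integrable_continuous: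
  fixes w :: "real \<Rightarrow> complex"
  assumes "continuous_on {0..1} w"
  shows "square_integrable w"
  using square_integrable_continuous_mult[OF assms square_integrable_const[of 1]] by simp

section \<open>Hoelder continuity, level sets and divergent integrals\<close>

lemma hoelder_on_imp_continuous_on:
  assumes "hoelder_on \<alpha> S f" "\<alpha> > 0"
  shows "continuous_on S f"
  unfolding continuous_on_def
proof
  fix x assume x: "x \<in> S"
  obtain C where C: "\<And>x y. x \<in> S \<Longrightarrow> y \<in> S \<Longrightarrow> \<bar>f x - f y\<bar> \<le> C * \<bar>x - y\<bar> powr \<alpha>"
    using assms(1) by (auto simp: hoelder_on_def)
  have "((\<lambda>y. C * \<bar>y - x\<bar> powr \<alpha>) \<longlongrightarrow> C * \<bar>x - x\<bar> powr \<alpha>) (at x within S)"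
    using assms(2) by (intro tendsto_intros) (auto intro!: always_eventually)
  then have "((\<lambda>y. C * \<bar>y - x\<bar> powr \<alpha>) \<longlongrightarrow> 0) (at x within S)"
    by simp
  then have "((\<lambda>y. f y - f x) \<longlongrightarrow> 0) (at x within S)"
    by (rule Lim_null_comparison[rotated]) (auto simp: eventually_at_filter C x)
  then show "(f \<longlongrightarrow> f x) (at x within S)"
    by (simp add: LIM_zero_iff)
qed

text \<open>The theorem measures the level set in the closed interval, whereas \<open>leb_I\<close>
  lives on the open one; the two endpoints form a null set.\<close>

lemma AE_leb_I_neq_iff:
  fixes u :: "real \<Rightarrow> real"
  assumes "continuous_on {0..1} u"
  shows "(AE x in leb_I. u x \<noteq> c) \<longleftrightarrow> measure lebesgue {x \<in> {0..1}. u x = c} = 0"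
proof -
  let ?Z = "{x \<in> {0..1}. u x = c}"
  have "closed ?Z"
    by (rule continuous_closed_preimage_constant[OF assms closed_atLeastAtMost])
  \<comment> \<open>\<open>measure\<close> is also 0 on nonmeasurable sets and on sets of infinite
    measure, so compactness is used first to exclude both.\<close>
  then have Z: "?Z \<in> lmeasurable"
    by (intro lmeasurable_compact) (auto simp: compact_eq_bounded_closed intro: bounded_subset[of "{0..1}"])
  have "(AE x in leb_I. u x \<noteq> c) \<longleftrightarrow> (AE x in lebesgue. x \<in> {0<..<1} \<longrightarrow> u x \<noteq> c)"
    by (subst AE_restrict_space_iff) auto
  also have "\<dots> \<longleftrightarrow> (AE x in lebesgue. x \<notin> ?Z)"
  proof -
    have "AE x in lebesgue. x \<notin> {0, 1::real}"
      by (intro AE_not_in) (simp flip: negligible_iff_null_sets)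
    then show ?thesis
      by (intro iffI; elim AE_mp) (auto intro!: AE_I2)
  qed
  also have "\<dots> \<longleftrightarrow> ?Z \<in> null_sets lebesgue"
    using Z by (subst AE_iff_null_sets) auto
  also have "\<dots> \<longleftrightarrow> measure lebesgue ?Z = 0"
    using emeasure_eq_measure2[OF Z] fmeasurableD[OF Z] by (simp add: null_sets_def)
  finally show ?thesis .
qed

text \<open>The primitive is a logarithm, unbounded near \<open>x0\<close>, so a one-sided interval
  close to \<open>x0\<close> already carries more than the supposed total \<open>M\<close>.\<close>

lemma not_integrable_inverse_abs_diff:
  fixes x0 :: real
  assumes "x0 \<in> {0..1}"
  shows "\<not> integrable leb_I (\<lambda>x. 1 / \<bar>x - x0\<bar>)"
proof
  let ?f = "\<lambda>x. 1 / \<bar>x - x0\<bar>"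
  assume int: "integrable leb_I ?f"
  have f: "?f integrable_on {0<..<1}"
    using int by (simp add: integrable_on_lebesgue_on)
  define M where "M = integral {0<..<1} ?f"
  have le_M: "I \<le> M" if "(?f has_integral I) S" "S \<subseteq> {0<..<1}" for I S
    unfolding M_def integral_unique[OF that(1), symmetric]
    by (rule integral_subset_le[OF that(2) _ f]) (use that in auto)
  have M: "0 \<le> M" unfolding M_def by (rule integral_nonneg[OF f]) auto
  \<comment> \<open>With this \<open>e\<close> the integral of \<open>?f\<close> over the distances
    from \<open>e\<close> to \<open>1/4\<close> is \<open>M + 1\<close>; \<open>M \<ge> 0\<close>
    ensures \<open>e < 1/4\<close>.\<close>
  define e where "e = exp (- M - 1) / 4"
  have e: "0 < e" "e < 1/4" using M by (auto simp: e_def)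
  have ln_e: "ln (1/4) - ln e = M + 1" unfolding e_def by (simp add: ln_div)
  show False
  \<comment> \<open>The interval is taken on the side of \<open>x0\<close> where distance
    \<open>1/4\<close> stays inside the open unit interval.\<close>
  proof (cases "x0 < 1/2")
    case True
    have "((\<lambda>x. 1 / (x - x0)) has_integral (ln (x0 + 1/4 - x0) - ln (x0 + e - x0))) {x0 + e..x0 + 1/4}"
      using e by (intro fundamental_theorem_of_calculus)
        (auto intro!: derivative_eq_intros simp: has_real_derivative_iff_has_vector_derivative[symmetric])
    then have "(?f has_integral (M + 1)) {x0 + e..x0 + 1/4}"
      using e ln_e by (subst has_integral_cong[where g = "\<lambda>x. 1 / (x - x0)"]) auto
    from le_M[OF this] show False using True e assms by (auto simp: subset_iff)
  next
    case False
    have "((\<lambda>x. 1 / (x0 - x)) has_integral ((- ln (x0 - (x0 - e))) - (- ln (x0 - (x0 - 1/4))))) {x0 - 1/4..x0 - e}"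
      using e by (intro fundamental_theorem_of_calculus)
        (auto intro!: derivative_eq_intros simp: has_real_derivative_iff_has_vector_derivative[symmetric])
    then have "(?f has_integral (M + 1)) {x0 - 1/4..x0 - e}"
      using e ln_e by (subst has_integral_cong[where g = "\<lambda>x. 1 / (x0 - x)"]) auto
    from le_M[OF this] show False using False e assms by (auto simp: subset_iff)
  qed
qed

text \<open>The fourth power of the Hoelder estimate is linear in the distance to \<open>x0\<close>,
  so \<open>1 / \<bar>x - x0\<bar>\<close> is at most a constant times the integrand. The hypothesis
  \<open>ne\<close> discards the points where division by zero would give the integrand the value
  0.\<close>

lemma not_integrable_inverse_power4_hoelder:
  fixes u :: "real \<Rightarrow> real"
  assumes u: "hoelder_on (1/4) {0..1} u" and x0: "x0 \<in> {0..1}"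
    and ne: "AE x in leb_I. u x \<noteq> u x0"
  shows "\<not> integrable leb_I (\<lambda>x. 1 / (u x - u x0) ^ 4)"
proof
  assume int: "integrable leb_I (\<lambda>x. 1 / (u x - u x0) ^ 4)"
  obtain C where C: "C \<ge> 0"
    "\<And>x y. x \<in> {0..1} \<Longrightarrow> y \<in> {0..1} \<Longrightarrow> \<bar>u x - u y\<bar> \<le> C * \<bar>x - y\<bar> powr (1/4)"
    using u by (auto simp: hoelder_on_def)
  have le: "(u x - u x0) ^ 4 \<le> C ^ 4 * \<bar>x - x0\<bar>" if "x \<in> {0..1}" for x
  proof -
    have "\<bar>u x - u x0\<bar> ^ 4 \<le> (C * \<bar>x - x0\<bar> powr (1/4)) ^ 4"
      by (intro power_mono C that x0) auto
    also have "\<dots> = C ^ 4 * \<bar>x - x0\<bar>"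
      by (cases "x = x0") (simp_all add: power_mult_distrib powr_power)
    finally show ?thesis by simp
  qed
  have "integrable leb_I (\<lambda>x. 1 / \<bar>x - x0\<bar>)"
  proof (rule Bochner_Integration.integrable_bound)
    show "integrable leb_I (\<lambda>x. C ^ 4 * (1 / (u x - u x0) ^ 4))"
      by (intro integrable_mult_right int)
    show "(\<lambda>x. 1 / \<bar>x - x0\<bar>) \<in> borel_measurable leb_I"
      by (intro borel_measurable_divide borel_measurable_abs borel_measurable_diff borel_measurable_const
          continuous_imp_measurable_on_sets_lebesgue continuous_intros) auto
    show "AE x in leb_I. norm (1 / \<bar>x - x0\<bar>) \<le> norm (C ^ 4 * (1 / (u x - u x0) ^ 4))"
      using ne AE_space
    proof eventually_elim
      case (elim x)
      then have "0 < (u x - u x0) ^ 4" "x \<noteq> x0" by auto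
      with le[of x] elim show ?case
        by (auto simp: space_leb_I field_simps)
    qed
  qed
  with not_integrable_inverse_abs_diff[OF x0] show False by simp
qed

subsection \<open>The shifted operator\<close>

locale B0_coeffs =
  fixes g :: real and u H :: "real \<Rightarrow> real"
  assumes g_pos: "g > 0"
    and u_hoelder: "hoelder_on (1/4) {0..1} u"
    and H_cont: "continuous_on {0..1} H"
    and H_pos: "\<And>x. x \<in> {0..1} \<Longrightarrow> H x > 0"
begin

definition shift :: "complex \<Rightarrow> l2 \<times> l2 \<times> l2 \<Rightarrow> l2 \<times> l2 \<times> l2"
  where "shift c \<phi> = B0 g u H \<phi> - c *\<^sub>C \<phi>"

lemma u_cont: "continuous_on {0..1} u"
  using hoelder_on_imp_continuous_on[OF u_hoelder] by simp

lemma shift_abs_l2: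
  assumes f: "square_integrable f1" "square_integrable f2" "square_integrable f3"
  shows "shift c (abs_l2 f1, abs_l2 f2, abs_l2 f3) =
    (abs_l2 (\<lambda>x. (of_real (u x) - c) * f1 x + of_real (H x) * f2 x),
     abs_l2 (\<lambda>x. of_real g * (\<integral>y. f1 y \<partial>leb_I) + (of_real (u x) - c) * f2 x + of_real g * f3 x),
     abs_l2 (\<lambda>x. - c * f3 x))"
proof -
  have "- abs_l2 h = abs_l2 (\<lambda>x. - h x)" if "square_integrable h" for h
    using that by (simp add: uminus_l2.abs_eq l2_rel_def)
  then show ?thesis
    unfolding shift_def B0_abs_l2[OF u_cont H_cont f]
    by (simp add: scaleC_prod_def scaleC_abs_l2 f minus_abs_l2 square_integrable_add
        square_integrable_coeff u_cont H_cont square_integrable_const square_integrable_cmult)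
       (simp add: algebra_simps)
qed

lemma square_integrable_shift:
  assumes f: "square_integrable f1" "square_integrable f2" "square_integrable f3"
  shows "square_integrable (\<lambda>x. (of_real (u x) - c) * f1 x + of_real (H x) * f2 x)"
    and "square_integrable (\<lambda>x. of_real g * (\<integral>y. f1 y \<partial>leb_I) + (of_real (u x) - c) * f2 x + of_real g * f3 x)"
    and "square_integrable (\<lambda>x. - c * f3 x)"
  by (intro square_integrable_add square_integrable_coeff square_integrable_const
      square_integrable_cmult square_integrable_continuous_mult continuous_intros u_cont H_cont f)+

text \<open>Translates between classes and functions, so that all later arguments can be
  pointwise.\<close>

lemma shift_eq_iff:
  assumes f: "square_integrable f1" "square_integrable f2" "square_integrable f3"
    and h: "square_integrable h1" "square_integrable h2" "square_integrable h3"
  shows "shift c (abs_l2 f1, abs_l2 f2, abs_l2 f3) = (abs_l2 h1, abs_l2 h2, abs_l2 h3) \<longleftrightarrow>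
    (AE x in leb_I. (of_real (u x) - c) * f1 x + of_real (H x) * f2 x = h1 x) \<and>
    (AE x in leb_I. of_real g * (\<integral>y. f1 y \<partial>leb_I) + (of_real (u x) - c) * f2 x + of_real g * f3 x = h2 x) \<and>
    (AE x in leb_I. - c * f3 x = h3 x)"
  unfolding shift_abs_l2[OF f] prod.inject
  by (simp only: abs_l2_eq_iff[OF square_integrable_shift(1)[OF f] h(1)]
      abs_l2_eq_iff[OF square_integrable_shift(2)[OF f] h(2)]
      abs_l2_eq_iff[OF square_integrable_shift(3)[OF f] h(3)])

text \<open>Real linearity is enough to reduce injectivity to a trivial kernel.\<close>

lemma linear_shift: "linear (shift c)"
proof (rule linearI)
  have C: "r *\<^sub>R x = complex_of_real r *\<^sub>C x" for r and x :: "l2 \<times> l2 \<times> l2"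
    by (rule scaleR_scaleC)
  note B = bounded_linear.linear[OF bounded_linear_B0[OF u_cont H_cont, of g]]
  show "shift c (\<phi> + \<psi>) = shift c \<phi> + shift c \<psi>" for \<phi> \<psi>
    by (simp add: shift_def linear_add[OF B] scaleC_add_right)
  show "shift c (r *\<^sub>R \<phi>) = r *\<^sub>R shift c \<phi>" for r \<phi>
    by (simp add: shift_def linear_scale[OF B] scaleR_diff_right)
       (simp add: C scaleC_scaleC mult.commute)
qed

text \<open>For \<open>c \<noteq> 0\<close> the third equation forces \<open>f3 = 0\<close>, which
  leaves a homogeneous system for \<open>f1\<close> and \<open>f2\<close>.\<close>

lemma inj_shiftI:
  assumes "c \<noteq> 0"
    and "\<And>f1 f2. square_integrable f1 \<Longrightarrow> square_integrable f2 \<Longrightarrow>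
      AE x in leb_I. (of_real (u x) - c) * f1 x + of_real (H x) * f2 x = 0 \<Longrightarrow>
      AE x in leb_I. of_real g * (\<integral>y. f1 y \<partial>leb_I) + (of_real (u x) - c) * f2 x = 0 \<Longrightarrow>
      (AE x in leb_I. f1 x = 0) \<and> (AE x in leb_I. f2 x = 0)"
  shows "inj (shift c)"
  unfolding linear_injective_0[OF linear_shift]
proof (intro allI impI)
  fix \<phi> assume 0: "shift c \<phi> = 0"
  obtain f1 f2 f3 where \<phi>: "\<phi> = (abs_l2 f1, abs_l2 f2, abs_l2 f3)"
    and f: "square_integrable f1" "square_integrable f2" "square_integrable f3"
    by (metis l2_cases prod_cases3)
  note z = square_integrable_0
  have zero: "(0 :: l2 \<times> l2 \<times> l2) = (abs_l2 (\<lambda>x. 0), abs_l2 (\<lambda>x. 0), abs_l2 (\<lambda>x. 0))"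
    by (simp add: zero_prod_def zero_l2.abs_eq)
  have *: "AE x in leb_I. (of_real (u x) - c) * f1 x + of_real (H x) * f2 x = 0"
    "AE x in leb_I. of_real g * (\<integral>y. f1 y \<partial>leb_I) + (of_real (u x) - c) * f2 x + of_real g * f3 x = 0"
    "AE x in leb_I. f3 x = 0"
    using 0 assms(1) unfolding \<phi> zero shift_eq_iff[OF f z z z] by simp_all
  have "AE x in leb_I. of_real g * (\<integral>y. f1 y \<partial>leb_I) + (of_real (u x) - c) * f2 x = 0"
    using *(2,3) by eventually_elim simp
  then show "\<phi> = 0"
    using assms(2)[OF f(1,2) *(1)] *(3) unfolding \<phi> zero prod.inject by (simp add: abs_l2_eq_iff f z)
qed

text \<open>Nontriviality is asked of \<open>f1\<close> alone, since every eigenvector constructed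
  below has a nonzero first component.\<close>

lemma not_inj_shiftI:
  assumes f: "square_integrable f1" "square_integrable f2" "square_integrable f3"
    and "AE x in leb_I. (of_real (u x) - c) * f1 x + of_real (H x) * f2 x = 0"
    and "AE x in leb_I. of_real g * (\<integral>y. f1 y \<partial>leb_I) + (of_real (u x) - c) * f2 x + of_real g * f3 x = 0"
    and "AE x in leb_I. c * f3 x = 0"
    and "\<not> (AE x in leb_I. f1 x = 0)"
  shows "\<not> inj (shift c)"
proof -
  note z = square_integrable_0
  have zero: "(0 :: l2 \<times> l2 \<times> l2) = (abs_l2 (\<lambda>x. 0), abs_l2 (\<lambda>x. 0), abs_l2 (\<lambda>x. 0))"
    by (simp add: zero_prod_def zero_l2.abs_eq)
  have "shift c (abs_l2 f1, abs_l2 f2, abs_l2 f3) = 0"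
    unfolding zero shift_eq_iff[OF f z z z] using assms by simp
  moreover have "(abs_l2 f1, abs_l2 f2, abs_l2 f3) \<noteq> 0"
    unfolding zero prod.inject using assms(7) by (simp add: abs_l2_eq_iff f z)
  ultimately show ?thesis
    unfolding linear_injective_0[OF linear_shift] by blast
qed

text \<open>For \<open>c = 0\<close> the third equation is void. So \<open>f1 = 1\<close> can be
  prescribed; the first equation then gives \<open>?f2\<close> because \<open>H\<close> has no zero,
  and the second gives \<open>?f3\<close>.\<close>

lemma not_inj_shift_0: "\<not> inj (shift 0)"
proof (rule not_inj_shiftI)
  let ?f2 = "\<lambda>x. complex_of_real (- u x / H x)"
  let ?f3 = "\<lambda>x. complex_of_real (u x * u x / (g * H x) - 1)"
  have nz: "\<forall>x\<in>{0..1}. H x \<noteq> 0" using H_pos by force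
  show "square_integrable (\<lambda>x. 1)" by (rule square_integrable_const)
  show "square_integrable ?f2" "square_integrable ?f3"
    using nz g_pos by (auto intro!: square_integrable_continuous continuous_intros u_cont H_cont)
  have 1: "H x \<noteq> 0" if "0 < x" "x < 1" for x using nz that by simp
  show "AE x in leb_I. (of_real (u x) - 0) * 1 + of_real (H x) * ?f2 x = 0"
    using 1 by (intro AE_I2) (auto simp: space_leb_I)
  show "AE x in leb_I. of_real g * (\<integral>y. 1 \<partial>leb_I) + (of_real (u x) - 0) * ?f2 x + of_real g * ?f3 x = 0"
    using 1 g_pos by (intro AE_I2) (auto simp: measure_restrict_space field_simps space_leb_I)
  show "\<not> (AE x in leb_I. (1::complex) = 0)"
    using not_AE_leb_I_False by simp
qed simp

subsection \<open>Outside the range of the velocity\<close>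

text \<open>\<open>1 - dispersion c\<close> is the factor of \<open>k\<close>, the integral of
  \<open>f1\<close>, in the scalar equation left after elimination.\<close>

definition dispersion :: "complex \<Rightarrow> complex"
  where "dispersion c = (\<integral>x. of_real (g * H x) / (c - of_real (u x))\<^sup>2 \<partial>leb_I)"

context
  fixes c :: complex
  assumes c: "c \<notin> complex_of_real ` u ` {0..1}"
begin

lemma off_range: "x \<in> {0..1} \<Longrightarrow> of_real (u x) - c \<noteq> 0"
  using c by auto

text \<open>Continuity on the compact interval makes multiplication by \<open>1 / (u - c)\<close>
  preserve square integrability.\<close>

lemma off_range_cont: "continuous_on {0..1} (\<lambda>x. 1 / (of_real (u x) - c))"
  using off_range by (intro continuous_intros u_cont) blast

lemma dispersion_kernel_cont:
  "continuous_on {0..1} (\<lambda>x. of_real (g * H x) * (1 / (of_real (u x) - c))\<^sup>2)"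
  by (intro continuous_intros off_range_cont H_cont)

lemma dispersion_alt:
  "dispersion c = (\<integral>x. of_real (g * H x) * (1 / (of_real (u x) - c))\<^sup>2 \<partial>leb_I)"
  unfolding dispersion_def by (simp add: power_divide power2_commute)

text \<open>The eigenvector is normalized so that \<open>f1\<close> has integral 1: the second
  equation then yields \<open>?f2\<close>, the first yields \<open>?f1\<close>, and
  \<open>dispersion c = 1\<close> says that the normalization is consistent.\<close>

lemma dispersion_eq_1_imp_not_inj:
  assumes "dispersion c = 1"
  shows "\<not> inj (shift c)"
proof (rule not_inj_shiftI)
  let ?f1 = "\<lambda>x. of_real (g * H x) * (1 / (of_real (u x) - c))\<^sup>2"
  let ?f2 = "\<lambda>x. - of_real g * (1 / (of_real (u x) - c))"
  show "square_integrable ?f1"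
    by (rule square_integrable_continuous[OF dispersion_kernel_cont])
  show "square_integrable ?f2"
    by (rule square_integrable_continuous, rule continuous_on_mult[OF continuous_on_const off_range_cont])
  show "square_integrable (\<lambda>x. 0)" by (rule square_integrable_0)
  show "AE x in leb_I. (of_real (u x) - c) * ?f1 x + of_real (H x) * ?f2 x = 0"
  proof (rule AE_I2)
    fix x assume "x \<in> space leb_I"
    define d where "d = of_real (u x) - c"
    have "d \<noteq> 0" using off_range[of x] \<open>x \<in> space leb_I\<close> by (simp add: d_def space_leb_I)
    then show "(of_real (u x) - c) * ?f1 x + of_real (H x) * ?f2 x = 0"
      unfolding d_def[symmetric] by (simp add: power2_eq_square)
  qed
  show "AE x in leb_I. of_real g * (\<integral>y. ?f1 y \<partial>leb_I) + (of_real (u x) - c) * ?f2 x + of_real g * 0 = 0"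
    using off_range assms unfolding dispersion_alt[symmetric] by (intro AE_I2) (simp add: space_leb_I)
  show "\<not> (AE x in leb_I. ?f1 x = 0)"
  proof
    assume "AE x in leb_I. ?f1 x = 0"
    then have "AE x in leb_I. False"
      using AE_space
    proof eventually_elim
      case (elim x)
      then have "x \<in> {0..1}" by (simp add: space_leb_I)
      with elim(1) off_range[of x] H_pos[of x] g_pos show ?case by auto
    qed
    then show False using not_AE_leb_I_False by blast
  qed
qed simp

text \<open>Elimination makes \<open>f1\<close> the multiple \<open>k\<close> of the dispersion
  kernel. Integrating gives \<open>k = k * dispersion c\<close>, hence \<open>k = 0\<close>, and
  both components vanish.\<close>

lemma dispersion_neq_1_imp_inj:
  assumes "c \<noteq> 0" "dispersion c \<noteq> 1"
  shows "inj (shift c)"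
proof (rule inj_shiftI[OF assms(1)])
  fix f1 f2 assume f: "square_integrable f1" "square_integrable f2"
  define k where "k = (\<integral>y. f1 y \<partial>leb_I)"
  define p where "p x = 1 / (of_real (u x) - c)" for x
  assume 1: "AE x in leb_I. (of_real (u x) - c) * f1 x + of_real (H x) * f2 x = 0"
    and 2: "AE x in leb_I. of_real g * (\<integral>y. f1 y \<partial>leb_I) + (of_real (u x) - c) * f2 x = 0"
  have *: "AE x in leb_I. f1 x = k * (of_real (g * H x) * (p x)\<^sup>2) \<and> f2 x = - of_real g * k * p x"
    using 1 2[folded k_def] AE_space
  proof eventually_elim
    case (elim x)
    define d where "d = of_real (u x) - c"
    have d: "d \<noteq> 0" "p x = 1 / d" using off_range[of x] elim(3) by (auto simp: d_def p_def space_leb_I)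
    have 2: "f2 x = - of_real g * k * p x"
      using elim(2) d unfolding d_def[symmetric] by (simp add: field_simps add_eq_0_iff)
    have 1: "f1 x = - of_real (H x) * f2 x / d"
      using elim(1) d unfolding d_def[symmetric] by (simp add: field_simps add_eq_0_iff)
    show ?case unfolding 1 2 d(2) by (simp add: power2_eq_square)
  qed
  have "(\<integral>x. f1 x \<partial>leb_I) = (\<integral>x. k * (of_real (g * H x) * (p x)\<^sup>2) \<partial>leb_I)"
  proof (rule integral_cong_AE)
    show "(\<lambda>x. k * (of_real (g * H x) * (p x)\<^sup>2)) \<in> borel_measurable leb_I"
      unfolding p_def by (intro square_integrable_measurable square_integrable_cmult
          square_integrable_continuous dispersion_kernel_cont)
  qed (use * f in \<open>auto simp: square_integrable_measurable\<close>)
  also have "\<dots> = k * dispersion c"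
    by (simp add: dispersion_alt p_def)
  finally have "k = 0" unfolding k_def[symmetric] using assms(2) by auto
  with * show "(AE x in leb_I. f1 x = 0) \<and> (AE x in leb_I. f2 x = 0)"
    by auto
qed

text \<open>The system is solved backwards, \<open>f3\<close> first, with \<open>k\<close> as a
  parameter; it remains to choose \<open>k\<close> so that it really is the integral of
  \<open>f1\<close>.\<close>

lemma dispersion_neq_1_imp_surj:
  assumes "c \<noteq> 0" "dispersion c \<noteq> 1"
  shows "range (shift c) = UNIV"
proof -
  have "\<exists>\<phi>. \<psi> = shift c \<phi>" for \<psi>
  proof -
    obtain h1 h2 h3 where \<psi>: "\<psi> = (abs_l2 h1, abs_l2 h2, abs_l2 h3)"
      and h: "square_integrable h1" "square_integrable h2" "square_integrable h3"
      by (metis l2_cases prod_cases3)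
    define p where "p x = 1 / (of_real (u x) - c)" for x
    define f3 where "f3 x = - 1 / c * h3 x" for x
    define q where "q x = h2 x - of_real g * f3 x" for x
    \<comment> \<open>The integral of the \<open>f1\<close> defined below is the numerator plus
      \<open>k * dispersion c\<close>; equating this with \<open>k\<close> gives the
      quotient.\<close>
    define k where "k = (\<integral>x. p x * h1 x - (of_real (H x) * (p x)\<^sup>2) * q x \<partial>leb_I) / (1 - dispersion c)"
    define f2 where "f2 x = p x * (q x - of_real g * k)" for x
    define f1 where "f1 x = p x * h1 x - of_real (H x) * (p x * f2 x)" for x
    note cont = off_range_cont[folded p_def]
    have f3: "square_integrable f3" unfolding f3_def by (intro square_integrable_cmult h)
    have q: "square_integrable q" unfolding q_def by (intro square_integrable_diff square_integrable_cmult h f3)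
    have f2: "square_integrable f2" unfolding f2_def
      by (intro square_integrable_continuous_mult[OF cont] square_integrable_diff square_integrable_const q)
    have f1: "square_integrable f1" unfolding f1_def
      by (intro square_integrable_diff square_integrable_continuous_mult[OF cont]
          square_integrable_coeff[OF H_cont] h f2)
    have int: "integrable leb_I (\<lambda>x. p x * h1 x - (of_real (H x) * (p x)\<^sup>2) * q x)"
      by (intro integrable_square_integrable square_integrable_diff square_integrable_continuous_mult
          continuous_intros cont H_cont h q)
    have int': "integrable leb_I (\<lambda>x. of_real (g * H x) * (p x)\<^sup>2)"
      unfolding p_def
      by (intro integrable_square_integrable square_integrable_continuous dispersion_kernel_cont)
    have "(\<integral>x. f1 x \<partial>leb_I) = (\<integral>x. (p x * h1 x - (of_real (H x) * (p x)\<^sup>2) * q x)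
        + k * (of_real (g * H x) * (p x)\<^sup>2) \<partial>leb_I)"
      unfolding f1_def f2_def by (simp add: power2_eq_square algebra_simps)
    also have "\<dots> = (\<integral>x. p x * h1 x - (of_real (H x) * (p x)\<^sup>2) * q x \<partial>leb_I) + k * dispersion c"
      unfolding dispersion_alt p_def[symmetric] integral_mult_right_zero[symmetric]
      by (intro Bochner_Integration.integral_add int integrable_mult_right int')
    also have "\<dots> = k"
      using assms(2) by (simp add: k_def field_simps)
    finally have k: "(\<integral>x. f1 x \<partial>leb_I) = k" .
    have d: "(of_real (u x) - c) * (p x * z) = z" if "x \<in> space leb_I" for x z
      using off_range[of x] that by (simp add: p_def space_leb_I)
    have "shift c (abs_l2 f1, abs_l2 f2, abs_l2 f3) = \<psi>"
      unfolding \<psi> shift_eq_iff[OF f1 f2 f3 h] k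
    proof (intro conjI AE_I2)
      fix x assume x: "x \<in> space leb_I"
      have "f1 x = p x * (h1 x - of_real (H x) * f2 x)"
        by (simp add: f1_def algebra_simps)
      then show "(of_real (u x) - c) * f1 x + of_real (H x) * f2 x = h1 x"
        by (simp only: d[OF x]) simp
      show "of_real g * k + (of_real (u x) - c) * f2 x + of_real g * f3 x = h2 x"
        unfolding f2_def d[OF x] by (simp add: q_def)
      show "- c * f3 x = h3 x"
        using assms(1) by (simp add: f3_def)
    qed
    then show ?thesis by metis
  qed
  then show ?thesis by blast
qed

end

subsection \<open>In the range of the velocity\<close>

lemma H_lower_bound: obtains h0 where "h0 > 0" "\<And>x. x \<in> {0..1} \<Longrightarrow> h0 \<le> H x"
proof -
  obtain x where "x \<in> {0..1}" "\<forall>y\<in>{0..1}. H x \<le> H y"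
    using continuous_attains_inf[OF compact_Icc _ H_cont] by auto
  with H_pos that show thesis by blast
qed

lemma u_measurable: "(\<lambda>x. complex_of_real (u x)) \<in> borel_measurable leb_I"
    "u \<in> borel_measurable leb_I"
proof -
  show "(\<lambda>x. complex_of_real (u x)) \<in> borel_measurable leb_I"
    using continuous_coeff[OF u_cont] by metis
  show "u \<in> borel_measurable leb_I"
    by (intro continuous_imp_measurable_on_sets_lebesgue continuous_on_subset[OF u_cont]) auto
qed

text \<open>On the level set \<open>u - c\<close> vanishes, so a function supported there with mean
  zero solves the system with \<open>f2 = f3 = 0\<close>. A centred coordinate provides one without
  splitting the level set.\<close>

lemma level_set_not_null_imp_not_inj:
  assumes "\<not> (AE x in leb_I. u x \<noteq> c)"
  shows "\<not> inj (shift (of_real c))"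
proof -
  define ind where "ind x = (if u x = c then 1 else 0 :: real)" for x
  define m where "m = (\<integral>x. ind x \<partial>leb_I)"
  \<comment> \<open>The barycentre of the level set, so that \<open>f\<close> has mean zero; on the
    level set \<open>f\<close> vanishes at most at the single point \<open>a\<close>.\<close>
  define a where "a = (\<integral>x. x * ind x \<partial>leb_I) / m"
  define f where "f x = complex_of_real ((x - a) * ind x)" for x
  have [measurable]: "u \<in> borel_measurable leb_I" by (rule u_measurable)
  have [measurable]: "(\<lambda>x. x) \<in> borel_measurable leb_I"
    by (rule continuous_imp_measurable_on_sets_lebesgue) auto
  have ind_meas [measurable]: "ind \<in> borel_measurable leb_I"
    unfolding ind_def by measurable
  have bounded: "integrable leb_I w" if "w \<in> borel_measurable leb_I" "\<And>x. x \<in> {0<..<1} \<Longrightarrow> \<bar>w x\<bar> \<le> 1"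
    for w :: "real \<Rightarrow> real"
    by (rule finite_measure.integrable_const_bound[OF finite_measure_leb_I, of _ 1])
      (use that in \<open>auto simp: space_leb_I\<close>)
  have int_ind: "integrable leb_I ind"
    by (rule bounded) (auto simp: ind_def)
  have int_xind: "integrable leb_I (\<lambda>x. x * ind x)"
    by (rule bounded) (auto simp: ind_def)
  have m: "m \<noteq> 0"
  proof
    assume "m = 0"
    then have "AE x in leb_I. ind x = 0"
      unfolding m_def by (subst (asm) integral_nonneg_eq_0_iff_AE[OF int_ind]) (auto simp: ind_def)
    then have "AE x in leb_I. u x \<noteq> c"
      by eventually_elim (auto simp: ind_def)
    with assms show False by blast
  qed
  have "square_integrable (\<lambda>x. complex_of_real (x - a) * of_real (ind x))"
    by (intro square_integrable_continuous_mult continuous_intros square_integrable_bound[where w = "\<lambda>x. 1"])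
      (auto simp: ind_def finite_measure.integrable_const[OF finite_measure_leb_I])
  then have f: "square_integrable f" by (simp add: f_def[abs_def])
  have "(\<integral>x. f x \<partial>leb_I) = of_real (\<integral>x. (x - a) * ind x \<partial>leb_I)"
    unfolding f_def by (rule integral_complex_of_real)
  also have "(\<integral>x. (x - a) * ind x \<partial>leb_I) = (\<integral>x. x * ind x \<partial>leb_I) - a * m"
    unfolding left_diff_distrib m_def integral_mult_right_zero[symmetric]
    by (intro Bochner_Integration.integral_diff int_xind integrable_mult_right int_ind)
  also have "\<dots> = 0"
    using m by (simp add: a_def)
  finally have int_f: "(\<integral>x. f x \<partial>leb_I) = 0" by simp
  show ?thesis
  proof (rule not_inj_shiftI[OF f square_integrable_0 square_integrable_0])
    show "\<not> (AE x in leb_I. f x = 0)"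
    proof
      assume 0: "AE x in leb_I. f x = 0"
      have "AE x in lebesgue. x \<notin> {a}"
        by (intro AE_not_in) (simp flip: negligible_iff_null_sets)
      then have "AE x in leb_I. x \<noteq> a"
        by (subst AE_restrict_space_iff) auto
      with 0 have "AE x in leb_I. u x \<noteq> c"
        by eventually_elim (auto simp: f_def ind_def)
      with assms show False by blast
    qed
    show "AE x in leb_I. (of_real (u x) - of_real c) * f x + of_real (H x) * 0 = 0"
      by (intro AE_I2) (simp add: f_def ind_def)
  qed (simp_all add: int_f)
qed

section \<open>Points of the range whose level set is null\<close>

context
  fixes c :: real
  assumes c_range: "c \<in> u ` {0..1}" and c_null: "AE x in leb_I. u x \<noteq> c"
begin

lemma not_integrable_inverse_power4: "\<not> integrable leb_I (\<lambda>x. 1 / (u x - c) ^ 4)"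
  using c_range c_null not_integrable_inverse_power4_hoelder[OF u_hoelder] by auto

text \<open>
  Eliminating \<open>f2\<close> gives \<open>f1 = \<kappa> H / (u - c)\<^sup>2\<close>, and by Hoelder continuity with exponent \<open>1/4\<close>
  this is square integrable only if \<open>\<kappa> = 0\<close>.
\<close>

lemma shift_constant_rhs:
  assumes f: "square_integrable f1" "square_integrable f2"
    and 1: "AE x in leb_I. (of_real (u x) - of_real c) * f1 x + of_real (H x) * f2 x = 0"
    and 2: "AE x in leb_I. \<kappa> + (of_real (u x) - of_real c) * f2 x = 0"
  shows "\<kappa> = 0" "AE x in leb_I. f1 x = 0" "AE x in leb_I. f2 x = 0"
proof -
  have *: "AE x in leb_I. f1 x = \<kappa> * of_real (H x) / (of_real (u x - c))\<^sup>2
      \<and> f2 x = - \<kappa> / of_real (u x - c)"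
    using 1 2 c_null
  proof eventually_elim
    case (elim x)
    define d where "d = complex_of_real (u x - c)"
    have d: "d \<noteq> 0" "of_real (u x) - of_real c = d" using elim(3) by (simp_all add: d_def)
    have 2: "f2 x = - \<kappa> / d"
      using elim(2) d(1) unfolding d(2) by (simp add: field_simps add_eq_0_iff)
    have 1: "f1 x = - of_real (H x) * f2 x / d"
      using elim(1) d(1) unfolding d(2) by (simp add: field_simps add_eq_0_iff)
    show ?case unfolding 1 2 d_def[symmetric] by (simp add: power2_eq_square)
  qed
  obtain h0 where h0: "h0 > 0" "\<And>x. x \<in> {0..1} \<Longrightarrow> h0 \<le> H x" using H_lower_bound by metis
  show \<kappa>: "\<kappa> = 0"
  proof (rule ccontr)
    assume \<kappa>: "\<kappa> \<noteq> 0"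
    have "integrable leb_I (\<lambda>x. 1 / (u x - c) ^ 4)"
    proof (rule Bochner_Integration.integrable_bound)
      \<comment> \<open>Since \<open>H \<ge> h0\<close>, the square of \<open>cmod (f1 x)\<close> is
        at least \<open>(cmod \<kappa> * h0)\<^sup>2 / (u x - c) ^ 4\<close>, so this multiple of it
        dominates the fourth inverse power.\<close>
      show "integrable leb_I (\<lambda>x. 1 / (cmod \<kappa> * h0)\<^sup>2 * (cmod (f1 x))\<^sup>2)"
        using f(1) by (intro integrable_mult_right) (simp add: square_integrable_def)
      show "(\<lambda>x. 1 / (u x - c) ^ 4) \<in> borel_measurable leb_I"
        by (intro borel_measurable_divide borel_measurable_power borel_measurable_diff
            borel_measurable_const u_measurable)
      show "AE x in leb_I. norm (1 / (u x - c) ^ 4) \<le> norm (1 / (cmod \<kappa> * h0)\<^sup>2 * (cmod (f1 x))\<^sup>2)"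
        using * AE_space
      proof eventually_elim
        case (elim x)
        have "(cmod \<kappa> * h0)\<^sup>2 \<le> (cmod \<kappa> * H x)\<^sup>2"
          using h0(1) h0(2)[of x] elim(2) by (intro power_mono mult_left_mono) (auto simp: space_leb_I)
        then have "1 \<le> (cmod \<kappa> * H x)\<^sup>2 / (cmod \<kappa> * h0)\<^sup>2"
          using \<kappa> h0(1) by simp
        then have "1 / (u x - c) ^ 4 \<le> (cmod \<kappa> * H x)\<^sup>2 / (cmod \<kappa> * h0)\<^sup>2 / (u x - c) ^ 4"
          by (intro divide_right_mono) auto
        also have "(cmod (f1 x))\<^sup>2 = (cmod \<kappa> * H x)\<^sup>2 / (u x - c) ^ 4"
          using conjunct1[OF elim(1)]
          by (simp add: norm_mult norm_divide norm_power power_divide power_mult_distrib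
               flip: of_real_diff)
        then have "(cmod \<kappa> * H x)\<^sup>2 / (cmod \<kappa> * h0)\<^sup>2 / (u x - c) ^ 4 = 1 / (cmod \<kappa> * h0)\<^sup>2 * (cmod (f1 x))\<^sup>2"
          by simp
        finally show ?case by simp
      qed
    qed
    with not_integrable_inverse_power4 show False by blast
  qed
  from * show "AE x in leb_I. f1 x = 0" "AE x in leb_I. f2 x = 0"
    by (simp_all add: \<kappa>)
qed

text \<open>This is \<open>shift_constant_rhs\<close> with \<open>g\<close> times the integral of
  \<open>f1\<close> as \<open>\<kappa>\<close>.\<close>

lemma level_set_null_imp_inj:
  assumes "c \<noteq> 0"
  shows "inj (shift (of_real c))"
proof (rule inj_shiftI)
  fix f1 f2 assume *: "square_integrable f1" "square_integrable f2"
    "AE x in leb_I. (of_real (u x) - of_real c) * f1 x + of_real (H x) * f2 x = 0"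
    "AE x in leb_I. of_real g * (\<integral>y. f1 y \<partial>leb_I) + (of_real (u x) - of_real c) * f2 x = 0"
  show "(AE x in leb_I. f1 x = 0) \<and> (AE x in leb_I. f2 x = 0)"
    by (intro conjI shift_constant_rhs(2,3)[OF *])
qed (use assms in simp)

text \<open>A preimage of \<open>(0, 1, 0)\<close> would have \<open>f3 = 0\<close> and satisfy
  \<open>shift_constant_rhs\<close> with \<open>\<kappa>\<close> equal to \<open>g\<close> times the
  integral of \<open>f1\<close>, minus 1. Then \<open>f1\<close> vanishes almost everywhere and
  \<open>\<kappa> = 0\<close> reads \<open>-1 = 0\<close>.\<close>

lemma level_set_null_imp_not_surj:
  assumes "c \<noteq> 0"
  shows "range (shift (of_real c)) \<noteq> UNIV"
proof
  note z = square_integrable_0 square_integrable_const[of 1] square_integrable_0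
  assume "range (shift (of_real c)) = UNIV"
  then have "(abs_l2 (\<lambda>x. 0), abs_l2 (\<lambda>x. 1), abs_l2 (\<lambda>x. 0)) \<in> range (shift (of_real c))"
    by simp
  then obtain \<phi> where "shift (of_real c) \<phi> = (abs_l2 (\<lambda>x. 0), abs_l2 (\<lambda>x. 1), abs_l2 (\<lambda>x. 0))"
    by (elim imageE) simp
  moreover obtain f1 f2 f3 where \<phi>: "\<phi> = (abs_l2 f1, abs_l2 f2, abs_l2 f3)"
    and f: "square_integrable f1" "square_integrable f2" "square_integrable f3"
    by (metis l2_cases prod_cases3)
  ultimately have 1: "AE x in leb_I. (of_real (u x) - of_real c) * f1 x + of_real (H x) * f2 x = 0"
    and 2: "AE x in leb_I. of_real g * (\<integral>y. f1 y \<partial>leb_I) + (of_real (u x) - of_real c) * f2 x + of_real g * f3 x = 1"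
    and 3: "AE x in leb_I. f3 x = 0"
    using assms by (simp_all add: shift_eq_iff f z)
  have "AE x in leb_I. (of_real g * (\<integral>y. f1 y \<partial>leb_I) - 1) + (of_real (u x) - of_real c) * f2 x = 0"
    using 2 3 by eventually_elim (simp add: algebra_simps)
  note * = shift_constant_rhs[OF f(1,2) 1 this]
  have "(\<integral>y. f1 y \<partial>leb_I) = (\<integral>y. 0 \<partial>leb_I)"
    by (rule integral_cong_AE) (use f * in \<open>auto simp: square_integrable_measurable\<close>)
  with *(1) show False by simp
qed

text \<open>A bounded substitute for \<open>1 / (u - c)\<close>. It is set to 0 near the level set,
  not capped, so that its product with \<open>u - c\<close> is an indicator function.
  \<open>Suc n\<close> keeps the threshold positive for \<open>n = 0\<close>.\<close>

definition cutoff_inverse :: "nat \<Rightarrow> real \<Rightarrow> real"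
  where "cutoff_inverse n x = (if 1 / real (Suc n) \<le> \<bar>u x - c\<bar> then 1 / (u x - c) else 0)"

lemma cutoff_inverse_measurable: "cutoff_inverse n \<in> borel_measurable leb_I"
proof -
  have [measurable]: "u \<in> borel_measurable leb_I" by (rule u_measurable)
  show ?thesis unfolding cutoff_inverse_def by measurable
qed

lemma abs_cutoff_inverse_le: "\<bar>cutoff_inverse n x\<bar> \<le> real (Suc n)"
proof (cases "1 / real (Suc n) \<le> \<bar>u x - c\<bar>")
  case True
  moreover have "0 < 1 / real (Suc n)" by simp
  ultimately have "0 < \<bar>u x - c\<bar>" by linarith
  with True show ?thesis by (simp add: cutoff_inverse_def field_simps)
qed (simp add: cutoff_inverse_def)

lemma square_integrable_cutoff_inverse_mult:
  assumes "square_integrable f"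
  shows "square_integrable (\<lambda>x. of_real (cutoff_inverse n x) * f x)"
proof (rule square_integrable_mult[OF assms])
  show "(\<lambda>x. complex_of_real (cutoff_inverse n x)) \<in> borel_measurable leb_I"
    by (rule measurable_compose[OF cutoff_inverse_measurable borel_measurable_of_real])
  show "cmod (of_real (cutoff_inverse n x)) \<le> real (Suc n)" for x
    using abs_cutoff_inverse_le[of n x] by simp
qed

lemma mult_cutoff_inverse:
  "(u x - c) * cutoff_inverse n x = (if 1 / real (Suc n) \<le> \<bar>u x - c\<bar> then 1 else 0)"
proof (cases "1 / real (Suc n) \<le> \<bar>u x - c\<bar>")
  case True
  moreover have "0 < 1 / real (Suc n)" by simp
  ultimately have "0 < \<bar>u x - c\<bar>" by linarith
  with True show ?thesis by (simp add: cutoff_inverse_def)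
qed (simp add: cutoff_inverse_def)

text \<open>The threshold eventually drops below \<open>\<bar>u x - c\<bar>\<close>. Eventual
  equality passes at once to every expression in the cutoff.\<close>

lemma eventually_cutoff_inverse:
  assumes "u x \<noteq> c"
  shows "eventually (\<lambda>n. cutoff_inverse n x = 1 / (u x - c)) sequentially"
proof -
  have "eventually (\<lambda>n. 1 / real (Suc n) < \<bar>u x - c\<bar>) sequentially"
    using assms LIMSEQ_inverse_real_of_nat
    by (intro order_tendstoD(2)[of _ 0]) (auto simp: inverse_eq_divide)
  then show ?thesis
    by eventually_elim (simp add: cutoff_inverse_def)
qed

text \<open>Either both cutoffs agree at \<open>x\<close> or the one at level \<open>m\<close> is 0
  there; the even power removes the sign of \<open>u x - c\<close>.\<close>

lemma cutoff_inverse_power4_mono: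
  assumes "m \<le> n"
  shows "cutoff_inverse m x ^ 4 \<le> cutoff_inverse n x ^ 4"
proof -
  have "1 / real (Suc n) \<le> 1 / real (Suc m)"
    using assms by (simp add: frac_le)
  then show ?thesis by (auto simp: cutoff_inverse_def)
qed

lemma integrable_cutoff_inverse_power4: "integrable leb_I (\<lambda>x. cutoff_inverse n x ^ 4)"
proof (rule finite_measure.integrable_const_bound[OF finite_measure_leb_I])
  show "AE x in leb_I. norm (cutoff_inverse n x ^ 4) \<le> real (Suc n) ^ 4"
    using power_mono[OF abs_cutoff_inverse_le[of n], of _ 4] by (intro AE_I2) simp
qed (intro borel_measurable_power cutoff_inverse_measurable)

text \<open>Otherwise monotone convergence would make the limit \<open>1 / (u - c) ^ 4\<close>
  integrable.\<close>

lemma integral_cutoff_inverse_power4_unbounded: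
  "\<exists>n. M < (\<integral>x. cutoff_inverse n x ^ 4 \<partial>leb_I)"
proof (rule ccontr)
  assume "\<not> ?thesis"
  then have le: "\<And>n. (\<integral>x. cutoff_inverse n x ^ 4 \<partial>leb_I) \<le> M" by (simp add: not_less)
  have "incseq (\<lambda>n. \<integral>x. cutoff_inverse n x ^ 4 \<partial>leb_I)"
    by (intro incseq_SucI integral_mono integrable_cutoff_inverse_power4 cutoff_inverse_power4_mono) simp
  then obtain L where L: "(\<lambda>n. \<integral>x. cutoff_inverse n x ^ 4 \<partial>leb_I) \<longlonglongrightarrow> L"
    using incseq_convergent[of _ M] le by blast
  have "integrable leb_I (\<lambda>x. 1 / (u x - c) ^ 4)"
  proof (rule integrable_monotone_convergence[OF integrable_cutoff_inverse_power4 _ _ L])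
    show "AE x in leb_I. mono (\<lambda>n. cutoff_inverse n x ^ 4)"
      by (intro AE_I2 monoI cutoff_inverse_power4_mono)
    show "AE x in leb_I. (\<lambda>n. cutoff_inverse n x ^ 4) \<longlonglongrightarrow> 1 / (u x - c) ^ 4"
      using c_null
    proof eventually_elim
      case (elim x)
      then show ?case
        by (intro tendsto_eventually eventually_mono[OF eventually_cutoff_inverse[OF elim]])
          (simp add: power_divide)
    qed
    show "(\<lambda>x. 1 / (u x - c) ^ 4) \<in> borel_measurable leb_I"
      by (intro borel_measurable_divide borel_measurable_power borel_measurable_diff
          borel_measurable_const u_measurable)
  qed
  with not_integrable_inverse_power4 show False by blast
qed

text \<open>The factor is an indicator that is eventually 1 at almost every point, so dominated
  convergence applies with the bound \<open>(cmod (f x))\<^sup>2\<close>.\<close>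

lemma cutoff_tendsto:
  assumes f: "square_integrable f"
  shows "(\<lambda>n. norm (abs_l2 (\<lambda>x. of_real ((u x - c) * cutoff_inverse n x) * f x) - abs_l2 f)) \<longlonglongrightarrow> 0"
proof -
  define w where "w n x = of_real ((u x - c) * cutoff_inverse n x) * f x" for n x
  have w: "square_integrable (w n)" for n
  proof -
    have "square_integrable (\<lambda>x. (of_real (u x) - of_real c) * (of_real (cutoff_inverse n x) * f x))"
      by (intro square_integrable_continuous_mult square_integrable_cutoff_inverse_mult f
          continuous_intros u_cont)
    then show ?thesis by (simp add: w_def[abs_def] mult.assoc)
  qed
  have "(\<lambda>n. \<integral>x. (cmod (w n x - f x))\<^sup>2 \<partial>leb_I) \<longlonglongrightarrow> (\<integral>x. 0 \<partial>leb_I)"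
  proof (rule integral_dominated_convergence[where w = "\<lambda>x. (cmod (f x))\<^sup>2"])
    show "(\<lambda>x. (cmod (w n x - f x))\<^sup>2) \<in> borel_measurable leb_I" for n
      using square_integrable_diff[OF w f] by (auto simp: square_integrable_def)
    show "integrable leb_I (\<lambda>x. (cmod (f x))\<^sup>2)"
      using f by (simp add: square_integrable_def)
    show "AE x in leb_I. (\<lambda>n. (cmod (w n x - f x))\<^sup>2) \<longlonglongrightarrow> 0"
      using c_null
    proof eventually_elim
      case (elim x)
      then show ?case
        by (intro tendsto_eventually eventually_mono[OF eventually_cutoff_inverse[OF elim]])
          (simp add: w_def)
    qed
    show "AE x in leb_I. norm ((cmod (w n x - f x))\<^sup>2) \<le> (cmod (f x))\<^sup>2" for n
      by (intro AE_I2) (simp add: w_def mult_cutoff_inverse)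
  qed simp
  from tendsto_real_sqrt[OF this]
  have "(\<lambda>n. norm (abs_l2 (w n) - abs_l2 f)) \<longlonglongrightarrow> 0"
    by (simp add: minus_abs_l2 w f norm_abs_l2 square_integrable_diff)
  then show ?thesis by (simp add: w_def[abs_def])
qed

text \<open>
  After cutting the right-hand side off near the level set, the first two equations can be solved
  explicitly. The perturbation \<open>a / (u - c)\<^sup>2\<close>, cut off at level \<open>n\<close>, of the second equation makes
  the integral of \<open>f1\<close> vanish; its norm can be made arbitrarily small because \<open>1 / (u - c)\<^sup>2\<close> is
  not square integrable.
\<close>

lemma level_set_null_imp_dense:
  assumes "c \<noteq> 0"
  shows "closure (range (shift (of_real c))) = UNIV"
proof -
  have "\<exists>\<phi>. dist (shift (of_real c) \<phi>) \<psi> < e" if e: "e > 0" for \<psi> e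
  proof -
    obtain h1 h2 h3 where \<psi>: "\<psi> = (abs_l2 h1, abs_l2 h2, abs_l2 h3)"
      and h: "square_integrable h1" "square_integrable h2" "square_integrable h3"
      by (metis l2_cases prod_cases3)
    define f3 where "f3 x = - 1 / of_real c * h3 x" for x
    define q where "q x = h2 x - of_real g * f3 x" for x
    have f3: "square_integrable f3" unfolding f3_def by (intro square_integrable_cmult h)
    have q: "square_integrable q" unfolding q_def by (intro square_integrable_diff square_integrable_cmult h f3)
    define P where "P n x = complex_of_real (cutoff_inverse n x)" for n x
    define D where "D x = complex_of_real (u x) - of_real c" for x
    have P: "square_integrable (\<lambda>x. P n x * f x)" if "square_integrable f" for n f
      unfolding P_def by (rule square_integrable_cutoff_inverse_mult[OF that])
    have DP: "square_integrable (\<lambda>x. D x * (P n x * f x))" if "square_integrable f" for n f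
      unfolding D_def by (intro square_integrable_continuous_mult P that continuous_intros u_cont)
    \<comment> \<open>One level \<open>m\<close> serves both right-hand sides; the last third of
      \<open>e\<close> is kept for the perturbation.\<close>
    obtain m where m: "norm (abs_l2 (\<lambda>x. D x * (P m x * h1 x)) - abs_l2 h1) < e / 3"
      "norm (abs_l2 (\<lambda>x. D x * (P m x * q x)) - abs_l2 q) < e / 3"
    proof -
      have "eventually (\<lambda>m. norm (abs_l2 (\<lambda>x. D x * (P m x * f x)) - abs_l2 f) < e / 3) sequentially"
        if "square_integrable f" for f
        using order_tendstoD(2)[OF cutoff_tendsto[OF that], of "e / 3"] e
        by (simp add: D_def P_def mult.assoc)
      from eventually_conj[OF this[OF h(1)] this[OF q]] that show thesis
        by (auto dest: eventually_happens)
    qed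
    obtain h0 where h0: "h0 > 0" "\<And>x. x \<in> {0..1} \<Longrightarrow> h0 \<le> H x" using H_lower_bound by metis
    \<comment> \<open>The integral that \<open>f1\<close> would have without the correction
      term.\<close>
    define A where "A = (\<integral>x. P m x * h1 x - of_real (H x) * (P m x * (P m x * q x)) \<partial>leb_I)"
    \<comment> \<open>The perturbation will have norm at most \<open>cmod A / (h0 * sqrt S)\<close>,
      and this bound on \<open>S\<close> brings it below \<open>e / 3\<close>. The level
      \<open>n\<close> is chosen after \<open>m\<close> because \<open>A\<close> depends on
      \<open>m\<close>.\<close>
    obtain n where n: "(3 * cmod A / (h0 * e))\<^sup>2 < (\<integral>x. cutoff_inverse n x ^ 4 \<partial>leb_I)"
      using integral_cutoff_inverse_power4_unbounded by blast
    define S where "S = (\<integral>x. cutoff_inverse n x ^ 4 \<partial>leb_I)"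
    define T where "T = (\<integral>x. H x * cutoff_inverse n x ^ 4 \<partial>leb_I)"
    have S: "S > 0" using n unfolding S_def[symmetric] by (rule le_less_trans[rotated]) simp
    have HP: "square_integrable (\<lambda>x. of_real (H x) * (P n x * (P n x * (P n x * (P n x * 1)))))"
      by (intro square_integrable_coeff[OF H_cont] P square_integrable_const)
    have "integrable leb_I (\<lambda>x. complex_of_real (H x * cutoff_inverse n x ^ 4))"
      using integrable_square_integrable[OF HP] by (simp add: P_def power4_eq_xxxx mult.assoc)
    then have intH: "integrable leb_I (\<lambda>x. H x * cutoff_inverse n x ^ 4)"
      by (simp only: complex_of_real_integrable_eq)
    have "h0 * S = (\<integral>x. h0 * cutoff_inverse n x ^ 4 \<partial>leb_I)"
      by (simp add: S_def)
    also have "\<dots> \<le> T"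
      unfolding T_def
      by (intro integral_mono integrable_mult_right integrable_cutoff_inverse_power4 intH mult_right_mono h0)
        (auto simp: space_leb_I)
    finally have T: "h0 * S \<le> T" .
    then have T0: "T > 0" using S h0 by (smt (verit) mult_pos_pos)
    \<comment> \<open>\<open>T\<close> is the coefficient of \<open>a\<close> in the integral of
      \<open>f1\<close>, so this value makes that integral 0.\<close>
    define a where "a = - A / of_real T"
    \<comment> \<open>Multiplication by \<open>D\<close> lowers the cubic term in \<open>P n\<close>
      to the square that perturbs the second equation; the fourth-order term of \<open>f1\<close>
      cancels the cubic one in the first equation.\<close>
    define f2 where "f2 x = P m x * q x - a * (P n x * (P n x * (P n x * 1)))" for x
    define f1 where "f1 x = (P m x * h1 x - of_real (H x) * (P m x * (P m x * q x)))
       + a * (of_real (H x) * (P n x * (P n x * (P n x * (P n x * 1)))))" for x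
    have sq1: "square_integrable (\<lambda>x. P m x * h1 x - of_real (H x) * (P m x * (P m x * q x)))"
      by (intro square_integrable_diff square_integrable_coeff[OF H_cont] P h q)
    have f2: "square_integrable f2" unfolding f2_def
      by (intro square_integrable_diff square_integrable_cmult P q square_integrable_const)
    have f1: "square_integrable f1" unfolding f1_def
      by (intro square_integrable_add square_integrable_cmult sq1 HP)
    have "(\<integral>x. f1 x \<partial>leb_I) = A + a * (\<integral>x. of_real (H x) * (P n x * (P n x * (P n x * (P n x * 1)))) \<partial>leb_I)"
      unfolding f1_def A_def integral_mult_right_zero[symmetric]
      by (intro Bochner_Integration.integral_add integrable_square_integrable sq1 square_integrable_cmult HP)
    also have "(\<integral>x. of_real (H x) * (P n x * (P n x * (P n x * (P n x * 1)))) \<partial>leb_I) = of_real T"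
      unfolding T_def integral_complex_of_real[symmetric] by (simp add: P_def power4_eq_xxxx mult.assoc)
    also have "A + a * of_real T = 0"
      using T0 by (simp add: a_def)
    finally have int_f1: "(\<integral>x. f1 x \<partial>leb_I) = 0" .
    \<comment> \<open>\<open>D * P k\<close> is the indicator of the set where \<open>P k\<close> is
      nonzero, so no error term appears.\<close>
    have DPP: "D x * P k x * P k x = P k x" for k x
    proof -
      have "D x * P k x = of_real ((u x - c) * cutoff_inverse k x)" by (simp add: D_def P_def)
      then show ?thesis unfolding mult_cutoff_inverse by (auto simp: P_def cutoff_inverse_def)
    qed
    have sqr: "square_integrable (\<lambda>x. P n x * (P n x * 1))"
      by (intro P square_integrable_const)
    have "D x * f1 x + of_real (H x) * f2 x = D x * (P m x * h1 x)
        - of_real (H x) * ((D x * P m x * P m x - P m x) * q x)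
        + a * (of_real (H x) * ((D x * P n x * P n x - P n x) * P n x * P n x))" for x
      by (simp add: f1_def f2_def algebra_simps)
    then have e1: "D x * f1 x + of_real (H x) * f2 x = D x * (P m x * h1 x)" for x
      by (simp add: DPP)
    have "D x * f2 x = D x * (P m x * q x) - a * (D x * P n x * P n x * P n x)" for x
      by (simp add: f2_def algebra_simps)
    then have e2: "D x * f2 x = D x * (P m x * q x) - a * (P n x * (P n x * 1))" for x
      by (simp add: DPP)
    have e3: "- of_real c * f3 x = h3 x" for x
      using assms by (simp add: f3_def)
    let ?d1 = "abs_l2 (\<lambda>x. D x * (P m x * h1 x)) - abs_l2 h1"
    let ?d2 = "abs_l2 (\<lambda>x. D x * (P m x * q x)) - abs_l2 q"
    let ?r = "abs_l2 (\<lambda>x. a * (P n x * (P n x * 1)))"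
    have r2: "abs_l2 (\<lambda>x. of_real g * 0 + (D x * (P m x * q x) - a * (P n x * (P n x * 1))) + of_real g * f3 x)
        - abs_l2 h2 = ?d2 - ?r"
    proof -
      have "?d2 - ?r = abs_l2 (\<lambda>x. (D x * (P m x * q x) - q x) - a * (P n x * (P n x * 1)))"
        by (simp only: minus_abs_l2 q DP sqr square_integrable_diff square_integrable_cmult)
      also have "\<dots> = abs_l2 (\<lambda>x. (of_real g * 0 + (D x * (P m x * q x) - a * (P n x * (P n x * 1)))
          + of_real g * f3 x) - h2 x)"
        by (simp add: q_def algebra_simps)
      also have "\<dots> = abs_l2 (\<lambda>x. of_real g * 0 + (D x * (P m x * q x) - a * (P n x * (P n x * 1)))
          + of_real g * f3 x) - abs_l2 h2"
        by (intro minus_abs_l2[symmetric] square_integrable_add square_integrable_diff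
            square_integrable_cmult square_integrable_0 DP q sqr f3 h)
      finally show ?thesis by (rule sym)
    qed
    have "shift (of_real c) (abs_l2 f1, abs_l2 f2, abs_l2 f3) - \<psi> = (?d1, ?d2 - ?r, 0)"
      unfolding \<psi> shift_abs_l2[OF f1 f2 f3] int_f1 D_def[symmetric] e1 e2 e3
      by (simp only: diff_Pair diff_self r2)
    then have "dist (shift (of_real c) (abs_l2 f1, abs_l2 f2, abs_l2 f3)) \<psi> \<le> norm ?d1 + (norm ?d2 + norm ?r)"
      unfolding dist_norm
      using norm_Pair_le[of ?d1 "(?d2 - ?r, 0::l2)"] norm_Pair_le[of "?d2 - ?r" "0::l2"]
        norm_triangle_ineq4[of ?d2 ?r] by simp
    moreover have "norm ?r \<le> e / 3"
    proof -
      have "(cmod (a * (P n x * (P n x * 1))))\<^sup>2 = (cmod a)\<^sup>2 * cutoff_inverse n x ^ 4" for x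
        by (simp add: P_def norm_mult power_mult_distrib power4_eq_xxxx power2_eq_square)
      then have "norm ?r = cmod a * sqrt S"
        by (simp only: norm_abs_l2[OF square_integrable_cmult[OF sqr]] integral_mult_right_zero
            S_def real_sqrt_mult real_sqrt_abs abs_norm_cancel)
      also have "\<dots> = cmod A * sqrt S / T"
        using T0 by (simp add: a_def norm_divide)
      \<comment> \<open>The lower bound \<open>h0 * S\<close> for \<open>T\<close> outweighs the
        \<open>sqrt S\<close> in the numerator and leaves \<open>sqrt S\<close> in the
        denominator.\<close>
      also have "\<dots> \<le> cmod A * sqrt S / (h0 * S)"
        using T T0 h0 S by (intro divide_left_mono) auto
      also have "\<dots> = cmod A / h0 / sqrt S"
        using S h0 by (simp add: field_simps)
      also have "\<dots> \<le> e / 3"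
      proof -
        have "3 * cmod A / (h0 * e) < sqrt S"
          using n unfolding S_def[symmetric] by (rule real_less_rsqrt)
        then show ?thesis using h0 e S by (simp add: field_simps)
      qed
      finally show ?thesis .
    qed
    ultimately have "dist (shift (of_real c) (abs_l2 f1, abs_l2 f2, abs_l2 f3)) \<psi> < e"
      using m by linarith
    then show ?thesis by blast
  qed
  then show ?thesis
    by (auto simp: closure_approachable)
qed

end

end

section \<open>Classification of every \<open>c\<close>: zero, the rest of the range of
  \<open>u\<close>, and the rest of its complement\<close>

theorem theorem4p16:
  fixes g :: real and u H :: "real \<Rightarrow> real"
  assumes "g > 0"
    and "hoelder_on (1/4) {0..1} u"
    and "continuous_on {0..1} H"
    and "\<forall>x\<in>{0..1}. H x > 0"
  shows "point_spectrum (B0 g u H) =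
      {0}
      \<union> {c. c \<notin> complex_of_real ` u ` {0..1} \<and>
            (\<integral>x. of_real (g * H x) / (c - of_real (u x))\<^sup>2 \<partial>leb_I) = 1}
      \<union> {c \<in> complex_of_real ` u ` {0..1} - {0}.
            measure lebesgue {x \<in> {0..1}. complex_of_real (u x) = c} > 0}
    \<and> continuous_spectrum (B0 g u H) =
      {c \<in> complex_of_real ` u ` {0..1} - {0}.
            measure lebesgue {x \<in> {0..1}. complex_of_real (u x) = c} = 0}
    \<and> residual_spectrum (B0 g u H) = {}"
proof -
  interpret B0_coeffs g u H
    by unfold_locales (use assms in auto)
  have spectra: "point_spectrum (B0 g u H) = {c. \<not> inj (shift c)}"
    "continuous_spectrum (B0 g u H) =
      {c. inj (shift c) \<and> closure (range (shift c)) = UNIV \<and> range (shift c) \<noteq> UNIV}"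
    "residual_spectrum (B0 g u H) = {c. inj (shift c) \<and> closure (range (shift c)) \<noteq> UNIV}"
    unfolding point_spectrum_def continuous_spectrum_def residual_spectrum_def shift_def[abs_def]
    by (rule refl)+
  \<comment> \<open>Off the range injectivity already gives surjectivity, so only point spectrum can
    occur there.\<close>
  have off: "inj (shift c) \<longleftrightarrow> dispersion c \<noteq> 1"
    "inj (shift c) \<Longrightarrow> range (shift c) = UNIV"
    if "c \<noteq> 0" "c \<notin> complex_of_real ` u ` {0..1}" for c
    using that dispersion_eq_1_imp_not_inj dispersion_neq_1_imp_inj dispersion_neq_1_imp_surj
    by metis+
  \<comment> \<open>On the range injectivity gives a dense proper range, so each nonzero point lies
    in the point or the continuous spectrum.\<close>
  have on: "measure lebesgue {x \<in> {0..1}. complex_of_real (u x) = c} = 0 \<longleftrightarrow> inj (shift c)"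
    "inj (shift c) \<Longrightarrow> closure (range (shift c)) = UNIV \<and> range (shift c) \<noteq> UNIV"
    if c: "c \<noteq> 0" "c \<in> complex_of_real ` u ` {0..1}" for c
  proof -
    \<comment> \<open>Points of the range of \<open>u\<close> are real, which is why the preceding
      results for real \<open>c\<close> suffice.\<close>
    obtain r where r: "c = of_real r" "r \<in> u ` {0..1}" "r \<noteq> 0" using c by auto
    have "measure lebesgue {x \<in> {0..1}. complex_of_real (u x) = c} = 0 \<longleftrightarrow> (AE x in leb_I. u x \<noteq> r)"
      unfolding AE_leb_I_neq_iff[OF u_cont] r(1) of_real_eq_iff by (rule refl)
    moreover have "\<not> (AE x in leb_I. u x \<noteq> r) \<Longrightarrow> \<not> inj (shift c)"
      unfolding r(1) by (rule level_set_not_null_imp_not_inj)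
    moreover have "inj (shift c) \<and> closure (range (shift c)) = UNIV \<and> range (shift c) \<noteq> UNIV"
      if "AE x in leb_I. u x \<noteq> r"
      unfolding r(1) by (intro conjI level_set_null_imp_inj level_set_null_imp_dense
          level_set_null_imp_not_surj r that)
    ultimately show "measure lebesgue {x \<in> {0..1}. complex_of_real (u x) = c} = 0 \<longleftrightarrow> inj (shift c)"
      and "inj (shift c) \<Longrightarrow> closure (range (shift c)) = UNIV \<and> range (shift c) \<noteq> UNIV"
      by blast+
  qed
  have pos: "measure lebesgue X > 0 \<longleftrightarrow> measure lebesgue X \<noteq> 0" for X :: "real set"
    by (simp add: zero_less_measure_iff)
  show ?thesis
    unfolding spectra dispersion_def[symmetric] pos
  proof (intro conjI set_eqI)
    fix c
    consider "c = 0" | "c \<noteq> 0" "c \<in> complex_of_real ` u ` {0..1}"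
      | "c \<noteq> 0" "c \<notin> complex_of_real ` u ` {0..1}" by blast
    note cases = this
    show "c \<in> {c. \<not> inj (shift c)} \<longleftrightarrow> c \<in> {0} \<union> {c. c \<notin> complex_of_real ` u ` {0..1} \<and> dispersion c = 1}
        \<union> {c \<in> complex_of_real ` u ` {0..1} - {0}.
            measure lebesgue {x \<in> {0..1}. complex_of_real (u x) = c} \<noteq> 0}"
      using off(1)[of c] on(1)[of c] not_inj_shift_0 by blast
    show "c \<in> {c. inj (shift c) \<and> closure (range (shift c)) = UNIV \<and> range (shift c) \<noteq> UNIV} \<longleftrightarrow>
        c \<in> {c \<in> complex_of_real ` u ` {0..1} - {0}.
            measure lebesgue {x \<in> {0..1}. complex_of_real (u x) = c} = 0}"
    proof (cases rule: cases)
      case 1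
      then show ?thesis using not_inj_shift_0 by simp
    next
      case 2
      show ?thesis
        unfolding mem_Collect_eq Diff_iff singleton_iff using 2 on[OF 2] by argo
    next
      case 3
      show ?thesis
        unfolding mem_Collect_eq Diff_iff singleton_iff using 3 off(2)[OF 3] by argo
    qed
    show "c \<in> {c. inj (shift c) \<and> closure (range (shift c)) \<noteq> UNIV} \<longleftrightarrow> c \<in> {}"
      unfolding mem_Collect_eq empty_iff
    proof (cases rule: cases)
      case 1
      then show "(inj (shift c) \<and> closure (range (shift c)) \<noteq> UNIV) = False"
        using not_inj_shift_0 by simp
    next
      case 2
      show "(inj (shift c) \<and> closure (range (shift c)) \<noteq> UNIV) = False"
        using on(2)[OF 2] by argo
    next
      case 3
      show "(inj (shift c) \<and> closure (range (shift c)) \<noteq> UNIV) = False"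
        using off(2)[OF 3] closure_UNIV by metis
    qed
  qed
qed

end
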